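(* For any $n\geq 2$ and any $p,q\in\mathbb N$, the action of the Casimir algebra $\mathcal C_{\mathfrak{sl}_n}$ on the (non-zero) weight spaces of the simple $\mathfrak{sl}_n(\mathbb C)$-module of highest weight $(p,0,\dots,0,-q)$ is irreducible.
   Context: Dominant integral weights of $\mathfrak{sl}_n$ are represented by non-increasing sequences in $\mathbb Z^n$ (modulo $(1,\dots,1)$). For $\mathfrak g=\mathfrak{sl}_n$ with Cartan subalgebra $\mathfrak h$ of diagonal matrices and root system $R$, fix a nonzero multiple $\langle\cdot,\cdot\rangle$ of the Killing form, and for $\alpha\in R$ let $e_\alpha\in\mathfrak g_\alpha$, $f_\alpha\in\mathfrak g_{-\alpha}$ with $[e_\alpha,f_\alpha]=\alpha^\vee$ and $\kappa_\alpha=\frac{\langle\alpha,\alpha\rangle}{2}(e_\alpha f_\alpha+f_\alpha e_\alpha)\in U\mathfrak g$. The Casimir algebra $\mathcal C_{\mathfrak g}\subseteq U\mathfrak g$ is the subalgebra generated by all $\kappa_\alpha$ and by $\mathfrak h$. *)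

theory Defs
  imports "Jordan_Normal_Form.Matrix" "HOL-Algebra.QuotRing" "HOL-Algebra.Generated_Rings"
    "HOL-Library.FuncSet"
begin

section \<open>The Lie algebra of traceless matrices\<close>

text \<open>Row and column indices run over \<open>0, ..., n - 1\<close>.\<close>

definition sl :: "nat \<Rightarrow> complex mat set" where
  "sl n = {X \<in> carrier_mat n n. (\<Sum>i<n. X $$ (i,i)) = 0}"

definition cartan :: "nat \<Rightarrow> complex mat set" where
  "cartan n = {H \<in> sl n. diagonal_mat H}"

definition lie_bracket :: "complex mat \<Rightarrow> complex mat \<Rightarrow> complex mat" where
  "lie_bracket X Y = X * Y - Y * X"

definition mat_unit :: "nat \<Rightarrow> nat \<Rightarrow> nat \<Rightarrow> complex mat" where
  "mat_unit n i j = mat n n (\<lambda>k. if k = (i, j) then 1 else 0)"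

text \<open>
  The trace of a linear endomorphism of \<open>sl n\<close>, computed in the basis consisting of the
  \<open>E i j\<close> with \<open>i \<noteq> j\<close> and the \<open>h k = E k k - E (k+1) (k+1)\<close> with \<open>k < n - 1\<close>.
  The coordinate of \<open>X\<close> at \<open>E i j\<close> is \<open>X i j\<close>; its coordinate at \<open>h k\<close> is the sum of the
  first \<open>k + 1\<close> diagonal entries of \<open>X\<close>.
\<close>

definition trace_on_sl :: "nat \<Rightarrow> (complex mat \<Rightarrow> complex mat) \<Rightarrow> complex" where
  "trace_on_sl n \<phi> =
     (\<Sum>i<n. \<Sum>j\<in>{..<n} - {i}. \<phi> (mat_unit n i j) $$ (i, j)) +
     (\<Sum>k<n - 1. \<Sum>i\<le>k. \<phi> (mat_unit n k k - mat_unit n (Suc k) (Suc k)) $$ (i, i))"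

definition killing_form :: "nat \<Rightarrow> complex mat \<Rightarrow> complex mat \<Rightarrow> complex" where
  "killing_form n X Y = trace_on_sl n (\<lambda>Z. lie_bracket X (lie_bracket Y Z))"


section \<open>Weights and roots\<close>

text \<open>
  Linear functionals on the Cartan subalgebra are extensional functions, so that a functional
  (in particular a root) is represented by exactly one HOL function.
\<close>

definition cartan_dual :: "nat \<Rightarrow> (complex mat \<Rightarrow> complex) set" where
  "cartan_dual n = {\<alpha> \<in> extensional (cartan n).
     (\<forall>H\<in>cartan n. \<forall>K\<in>cartan n. \<alpha> (H + K) = \<alpha> H + \<alpha> K) \<and>
     (\<forall>a. \<forall>H\<in>cartan n. \<alpha> (a \<cdot>\<^sub>m H) = a * \<alpha> H)}"

definition root_space :: "nat \<Rightarrow> (complex mat \<Rightarrow> complex) \<Rightarrow> complex mat set" where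
  "root_space n \<alpha> = {X \<in> sl n. \<forall>H\<in>cartan n. lie_bracket H X = \<alpha> H \<cdot>\<^sub>m X}"

definition roots :: "nat \<Rightarrow> (complex mat \<Rightarrow> complex) set" where
  "roots n = {\<alpha> \<in> cartan_dual n. (\<exists>H\<in>cartan n. \<alpha> H \<noteq> 0) \<and> root_space n \<alpha> \<noteq> {0\<^sub>m n n}}"

text \<open>
  In the following, \<open>c\<close> is the nonzero factor by which the chosen invariant form differs from
  the Killing form.  The form on the dual of the Cartan subalgebra is transported along the
  isomorphism given by the form on the Cartan subalgebra.
\<close>

definition inv_form :: "nat \<Rightarrow> complex \<Rightarrow> complex mat \<Rightarrow> complex mat \<Rightarrow> complex" where
  "inv_form n c X Y = c * killing_form n X Y"

definition riesz :: "nat \<Rightarrow> complex \<Rightarrow> (complex mat \<Rightarrow> complex) \<Rightarrow> complex mat" where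
  "riesz n c \<alpha> = (THE T. T \<in> cartan n \<and> (\<forall>H\<in>cartan n. inv_form n c T H = \<alpha> H))"

definition dual_form ::
  "nat \<Rightarrow> complex \<Rightarrow> (complex mat \<Rightarrow> complex) \<Rightarrow> (complex mat \<Rightarrow> complex) \<Rightarrow> complex" where
  "dual_form n c \<alpha> \<beta> = inv_form n c (riesz n c \<alpha>) (riesz n c \<beta>)"

definition coroot :: "nat \<Rightarrow> complex \<Rightarrow> (complex mat \<Rightarrow> complex) \<Rightarrow> complex mat" where
  "coroot n c \<alpha> = (2 / dual_form n c \<alpha> \<alpha>) \<cdot>\<^sub>m riesz n c \<alpha>"

definition root_vectors :: "nat \<Rightarrow> complex \<Rightarrow> ((complex mat \<Rightarrow> complex) \<Rightarrow> complex mat) \<Rightarrow>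
    ((complex mat \<Rightarrow> complex) \<Rightarrow> complex mat) \<Rightarrow> bool" where
  "root_vectors n c e f \<longleftrightarrow> (\<forall>\<alpha>\<in>roots n.
     e \<alpha> \<in> root_space n \<alpha> \<and> f \<alpha> \<in> root_space n (\<lambda>H. - \<alpha> H) \<and>
     lie_bracket (e \<alpha>) (f \<alpha>) = coroot n c \<alpha>)"

text \<open>The weight represented by an integer sequence \<open>l 0, ..., l (n - 1)\<close>.\<close>

definition weight_of :: "nat \<Rightarrow> (nat \<Rightarrow> int) \<Rightarrow> complex mat \<Rightarrow> complex" where
  "weight_of n l = (\<lambda>H\<in>cartan n. \<Sum>i<n. of_int (l i) * H $$ (i, i))"


section \<open>The universal enveloping algebra\<close>

text \<open>
  The free unital complex algebra on a set \<open>S\<close>: finitely supported functions on words over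
  \<open>S\<close>, with convolution along concatenation as product.
\<close>

definition free_algebra :: "'x set \<Rightarrow> ('x list \<Rightarrow> complex) ring" where
  "free_algebra S =
    \<lparr> carrier = {a. finite {w. a w \<noteq> 0} \<and> {w. a w \<noteq> 0} \<subseteq> lists S},
      mult = (\<lambda>a b w. \<Sum>(u, v) | u @ v = w. a u * b v),
      one = (\<lambda>w. if w = [] then 1 else 0),
      zero = (\<lambda>w. 0),
      add = (\<lambda>a b w. a w + b w) \<rparr>"

lemma splits_eq: "{(u, v). u @ v = w} = (\<lambda>i. (take i w, drop i w)) ` {..length w}"
proof -
  have "(u, v) \<in> (\<lambda>i. (take i w, drop i w)) ` {..length w}" if "u @ v = w" for u v
    using that by (intro image_eqI[of _ _ "length u"]) auto
  then show ?thesis by auto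
qed

lemma finite_splits: "finite {(u, v). u @ v = w}"
  by (simp add: splits_eq)

lemma free_mult_supp:
  fixes a b :: "'x list \<Rightarrow> complex"
  shows "{w. (\<Sum>(u, v) | u @ v = w. a u * b v) \<noteq> 0}
    \<subseteq> (\<lambda>(u, v). u @ v) ` ({u. a u \<noteq> 0} \<times> {v. b v \<noteq> 0})"
proof
  fix w assume "w \<in> {w. (\<Sum>(u, v) | u @ v = w. a u * b v) \<noteq> 0}"
  then have "\<exists>x\<in>{(u, v). u @ v = w}. (case x of (u, v) \<Rightarrow> a u * b v) \<noteq> 0"
    by (metis (mono_tags, lifting) mem_Collect_eq sum.neutral)
  then show "w \<in> (\<lambda>(u, v). u @ v) ` ({u. a u \<noteq> 0} \<times> {v. b v \<noteq> 0})"
    by force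
qed

lemma free_mult_assoc:
  fixes a b d :: "'x list \<Rightarrow> complex"
  shows "(\<Sum>(u, v) | u @ v = w. (\<Sum>(s, t) | s @ t = u. a s * b t) * d v) =
         (\<Sum>(u, v) | u @ v = w. a u * (\<Sum>(s, t) | s @ t = v. b s * d t))"
proof -
  have "(\<Sum>(u, v) | u @ v = w. (\<Sum>(s, t) | s @ t = u. a s * b t) * d v) =
    (\<Sum>((u, v), (s, t)) \<in> (SIGMA p:{(u, v). u @ v = w}. {(s, t). s @ t = fst p}). a s * b t * d v)"
    by (subst sum.Sigma[symmetric]) (auto simp: finite_splits sum_distrib_right case_prod_beta)
  also have "\<dots> = (\<Sum>((u, v), (s, t)) \<in> (SIGMA p:{(u, v). u @ v = w}. {(s, t). s @ t = snd p}).
      a u * (b s * d t))"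
    by (rule sum.reindex_bij_witness[where i = "\<lambda>((u, v), (s, t)). ((u @ s, t), (u, s))"
          and j = "\<lambda>((u, v), (s, t)). ((s, t @ v), (t, v))"]) auto
  also have "\<dots> = (\<Sum>(u, v) | u @ v = w. a u * (\<Sum>(s, t) | s @ t = v. b s * d t))"
    by (subst sum.Sigma[symmetric]) (auto simp: finite_splits sum_distrib_left case_prod_beta)
  finally show ?thesis .
qed

lemma ring_free_algebra: "ring (free_algebra (S :: 'a set))"
proof (rule ringI)
  show "abelian_group (free_algebra S)"
  proof (rule abelian_groupI)
    fix x y assume "x \<in> carrier (free_algebra S)" "y \<in> carrier (free_algebra S)"
    then have "finite ({w. x w \<noteq> 0} \<union> {w. y w \<noteq> 0})" "{w. x w \<noteq> 0} \<union> {w. y w \<noteq> 0} \<subseteq> lists S"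
      by (simp_all add: free_algebra_def)
    moreover have "{w. x w + y w \<noteq> 0} \<subseteq> {w. x w \<noteq> 0} \<union> {w. y w \<noteq> 0}"
      by auto
    ultimately show "x \<oplus>\<^bsub>free_algebra S\<^esub> y \<in> carrier (free_algebra S)"
      unfolding free_algebra_def by (auto intro: finite_subset)
  next
    fix x assume x: "x \<in> carrier (free_algebra S)"
    show "\<exists>y\<in>carrier (free_algebra S). y \<oplus>\<^bsub>free_algebra S\<^esub> x = \<zero>\<^bsub>free_algebra S\<^esub>"
      by (rule bexI[of _ "\<lambda>w. - x w"]) (use x in \<open>auto simp: free_algebra_def\<close>)
  qed (auto simp: free_algebra_def add.assoc add.commute)
  show "monoid (free_algebra S)"
  proof (rule monoidI)
    fix x y assume xy: "x \<in> carrier (free_algebra S)" "y \<in> carrier (free_algebra S)"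
    let ?I = "(\<lambda>(u, v). u @ v) ` ({u. x u \<noteq> 0} \<times> {v. y v \<noteq> 0})"
    have I: "finite ?I" "?I \<subseteq> lists S"
      using xy by (force simp: free_algebra_def)+
    have "{w. (x \<otimes>\<^bsub>free_algebra S\<^esub> y) w \<noteq> 0} \<subseteq> ?I"
      using free_mult_supp[of x y] by (simp add: free_algebra_def)
    with I have "finite {w. (x \<otimes>\<^bsub>free_algebra S\<^esub> y) w \<noteq> 0}"
      "{w. (x \<otimes>\<^bsub>free_algebra S\<^esub> y) w \<noteq> 0} \<subseteq> lists S"
      by (blast intro: finite_subset)+
    then show "x \<otimes>\<^bsub>free_algebra S\<^esub> y \<in> carrier (free_algebra S)"
      by (simp add: free_algebra_def)
  next
    fix x :: "'a list \<Rightarrow> complex"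
    have "(\<Sum>(u, v) | u @ v = w. (if u = [] then 1 else 0) * x v) = x w" for w
    proof -
      have "(\<Sum>(u, v) | u @ v = w. (if u = [] then 1 else 0) * x v) = (\<Sum>(u, v)\<in>{([] :: 'a list, w)}. x v)"
        by (rule sum.mono_neutral_cong_right) (auto simp: finite_splits split: if_splits)
      then show ?thesis by simp
    qed
    then show "\<one>\<^bsub>free_algebra S\<^esub> \<otimes>\<^bsub>free_algebra S\<^esub> x = x"
      by (simp add: free_algebra_def)
    have "(\<Sum>(u, v) | u @ v = w. x u * (if v = [] then 1 else 0)) = x w" for w
    proof -
      have "(\<Sum>(u, v) | u @ v = w. x u * (if v = [] then 1 else 0)) = (\<Sum>(u, v)\<in>{(w, [] :: 'a list)}. x u)"
        by (rule sum.mono_neutral_cong_right) (auto simp: finite_splits split: if_splits)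
      then show ?thesis by simp
    qed
    then show "x \<otimes>\<^bsub>free_algebra S\<^esub> \<one>\<^bsub>free_algebra S\<^esub> = x"
      by (simp add: free_algebra_def)
  qed (auto simp: free_algebra_def free_mult_assoc)
qed (auto simp: free_algebra_def algebra_simps sum.distrib case_prod_beta)

definition free_word :: "complex \<Rightarrow> 'x list \<Rightarrow> 'x list \<Rightarrow> complex" where
  "free_word a u = (\<lambda>w. if w = u then a else 0)"

text \<open>
  \<open>U(sl n)\<close> is the free algebra on the set \<open>sl n\<close>, modulo the relations that make the
  canonical map from \<open>sl n\<close> linear (this gives the tensor algebra) and a homomorphism of
  Lie algebras.
\<close>

definition env_relations :: "nat \<Rightarrow> (complex mat list \<Rightarrow> complex) set" where
  "env_relations n =
     {(\<lambda>w. free_word 1 [a \<cdot>\<^sub>m X + b \<cdot>\<^sub>m Y] w - free_word a [X] w - free_word b [Y] w)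
       | a b X Y. X \<in> sl n \<and> Y \<in> sl n} \<union>
     {(\<lambda>w. free_word 1 [X, Y] w - free_word 1 [Y, X] w - free_word 1 [lie_bracket X Y] w)
       | X Y. X \<in> sl n \<and> Y \<in> sl n}"

definition env_ideal :: "nat \<Rightarrow> (complex mat list \<Rightarrow> complex) set" where
  "env_ideal n = Idl\<^bsub>free_algebra (sl n)\<^esub> (env_relations n)"

definition univ_env :: "nat \<Rightarrow> (complex mat list \<Rightarrow> complex) set ring" where
  "univ_env n = free_algebra (sl n) Quot env_ideal n"

lemma sl_lincomb: "X \<in> sl n \<Longrightarrow> Y \<in> sl n \<Longrightarrow> a \<cdot>\<^sub>m X + b \<cdot>\<^sub>m Y \<in> sl n"
  by (auto simp: sl_def sum.distrib simp flip: sum_distrib_left)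

lemma sl_bracket: "X \<in> sl n \<Longrightarrow> Y \<in> sl n \<Longrightarrow> lie_bracket X Y \<in> sl n"
proof -
  assume X: "X \<in> sl n" and Y: "Y \<in> sl n"
  have "(\<Sum>i<n. (X * Y) $$ (i, i)) = (\<Sum>i<n. \<Sum>k<n. X $$ (i, k) * Y $$ (k, i))"
    using X Y by (intro sum.cong) (auto simp: sl_def scalar_prod_def lessThan_atLeast0)
  also have "\<dots> = (\<Sum>k<n. \<Sum>i<n. X $$ (i, k) * Y $$ (k, i))"
    by (rule sum.swap)
  also have "\<dots> = (\<Sum>i<n. (Y * X) $$ (i, i))"
    using X Y by (intro sum.cong) (auto simp: sl_def scalar_prod_def lessThan_atLeast0 mult.commute)
  finally show ?thesis
    using X Y by (auto simp: sl_def lie_bracket_def sum_subtractf)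
qed

lemma free_word_carrier: "w \<in> lists S \<Longrightarrow> free_word a w \<in> carrier (free_algebra S)"
  by (auto simp: free_algebra_def free_word_def)

lemma free_diff_carrier:
  assumes "x \<in> carrier (free_algebra S)" "y \<in> carrier (free_algebra S)"
  shows "(\<lambda>w. x w - y w) \<in> carrier (free_algebra S)"
proof -
  have "finite ({w. x w \<noteq> 0} \<union> {w. y w \<noteq> 0})" "{w. x w \<noteq> 0} \<union> {w. y w \<noteq> 0} \<subseteq> lists S"
    using assms by (simp_all add: free_algebra_def)
  moreover have "{w. x w - y w \<noteq> 0} \<subseteq> {w. x w \<noteq> 0} \<union> {w. y w \<noteq> 0}"
    by auto
  ultimately show ?thesis
    unfolding free_algebra_def by (auto intro: finite_subset)
qed

lemma env_relations_carrier: "env_relations n \<subseteq> carrier (free_algebra (sl n))"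
  by (auto simp: env_relations_def intro!: free_diff_carrier free_word_carrier sl_lincomb sl_bracket)

lemma ideal_env_ideal: "ideal (env_ideal n) (free_algebra (sl n))"
  unfolding env_ideal_def by (intro ring.genideal_ideal ring_free_algebra env_relations_carrier)

lemma ring_univ_env: "ring (univ_env n)"
  unfolding univ_env_def by (intro ideal.quotient_is_ring ideal_env_ideal)

definition env_scalar :: "nat \<Rightarrow> complex \<Rightarrow> (complex mat list \<Rightarrow> complex) set" where
  "env_scalar n a = env_ideal n +>\<^bsub>free_algebra (sl n)\<^esub> free_word a []"

definition env_incl :: "nat \<Rightarrow> complex mat \<Rightarrow> (complex mat list \<Rightarrow> complex) set" where
  "env_incl n X = env_ideal n +>\<^bsub>free_algebra (sl n)\<^esub> free_word 1 [X]"

definition kappa :: "nat \<Rightarrow> complex \<Rightarrow> ((complex mat \<Rightarrow> complex) \<Rightarrow> complex mat) \<Rightarrow>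
    ((complex mat \<Rightarrow> complex) \<Rightarrow> complex mat) \<Rightarrow> (complex mat \<Rightarrow> complex) \<Rightarrow>
    (complex mat list \<Rightarrow> complex) set" where
  "kappa n c e f \<alpha> = env_scalar n (dual_form n c \<alpha> \<alpha> / 2) \<otimes>\<^bsub>univ_env n\<^esub>
     (env_incl n (e \<alpha>) \<otimes>\<^bsub>univ_env n\<^esub> env_incl n (f \<alpha>) \<oplus>\<^bsub>univ_env n\<^esub>
      env_incl n (f \<alpha>) \<otimes>\<^bsub>univ_env n\<^esub> env_incl n (e \<alpha>))"

text \<open>The complex subalgebra generated by a set is the subring generated by it and the scalars.\<close>

definition casimir_algebra :: "nat \<Rightarrow> complex \<Rightarrow> ((complex mat \<Rightarrow> complex) \<Rightarrow> complex mat) \<Rightarrow>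
    ((complex mat \<Rightarrow> complex) \<Rightarrow> complex mat) \<Rightarrow> (complex mat list \<Rightarrow> complex) set set" where
  "casimir_algebra n c e f = generate_ring (univ_env n)
     (range (env_scalar n) \<union> kappa n c e f ` roots n \<union> env_incl n ` cartan n)"


section \<open>Representations\<close>

text \<open>
  A representation of \<open>sl n\<close> on the complex vector space whose underlying set is the whole type
  \<open>'v\<close>; the values of \<open>\<rho>\<close> outside \<open>sl n\<close> are irrelevant.
\<close>

locale sl_rep = vector_space scale
  for n :: nat and scale :: "complex \<Rightarrow> 'v::ab_group_add \<Rightarrow> 'v"
    and \<rho> :: "complex mat \<Rightarrow> 'v \<Rightarrow> 'v" +
  assumes linear_rep: "X \<in> sl n \<Longrightarrow> Vector_Spaces.linear scale scale (\<rho> X)"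
    and rep_add: "X \<in> sl n \<Longrightarrow> Y \<in> sl n \<Longrightarrow> \<rho> (X + Y) v = \<rho> X v + \<rho> Y v"
    and rep_smult: "X \<in> sl n \<Longrightarrow> \<rho> (a \<cdot>\<^sub>m X) v = scale a (\<rho> X v)"
    and rep_bracket: "X \<in> sl n \<Longrightarrow> Y \<in> sl n \<Longrightarrow>
      \<rho> (lie_bracket X Y) v = \<rho> X (\<rho> Y v) - \<rho> Y (\<rho> X v)"

text \<open>
  The set \<open>A\<close> of operators, acting through \<open>act\<close>, acts irreducibly on the subspace \<open>W\<close>
  (which is required to be stable and nonzero).
\<close>

definition acts_irreducibly :: "(complex \<Rightarrow> 'v::ab_group_add \<Rightarrow> 'v) \<Rightarrow>
    ('a \<Rightarrow> 'v \<Rightarrow> 'v) \<Rightarrow> 'a set \<Rightarrow> 'v set \<Rightarrow> bool" where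
  "acts_irreducibly scale act A W \<longleftrightarrow>
     Modules.module.subspace scale W \<and> W \<noteq> {0} \<and> (\<forall>a\<in>A. \<forall>w\<in>W. act a w \<in> W) \<and>
     (\<forall>S\<subseteq>W. Modules.module.subspace scale S \<and> (\<forall>a\<in>A. \<forall>w\<in>S. act a w \<in> S) \<longrightarrow>
        S = {0} \<or> S = W)"

definition weight_space :: "nat \<Rightarrow> (complex \<Rightarrow> 'v::ab_group_add \<Rightarrow> 'v) \<Rightarrow>
    (complex mat \<Rightarrow> 'v \<Rightarrow> 'v) \<Rightarrow> (complex mat \<Rightarrow> complex) \<Rightarrow> 'v set" where
  "weight_space n scale \<rho> \<mu> = {v. \<forall>H\<in>cartan n. \<rho> H v = scale (\<mu> H) v}"

text \<open>The Borel subalgebra is that of the upper triangular matrices.\<close>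

definition has_highest_weight :: "nat \<Rightarrow> (complex \<Rightarrow> 'v::ab_group_add \<Rightarrow> 'v) \<Rightarrow>
    (complex mat \<Rightarrow> 'v \<Rightarrow> 'v) \<Rightarrow> (complex mat \<Rightarrow> complex) \<Rightarrow> bool" where
  "has_highest_weight n scale \<rho> \<Lambda> \<longleftrightarrow> (\<exists>v\<in>weight_space n scale \<rho> \<Lambda>. v \<noteq> 0 \<and>
     (\<forall>i j. i < j \<longrightarrow> j < n \<longrightarrow> \<rho> (mat_unit n i j) v = 0))"

definition simple_highest_weight_module :: "nat \<Rightarrow> (complex \<Rightarrow> 'v::ab_group_add \<Rightarrow> 'v) \<Rightarrow>
    (complex mat \<Rightarrow> 'v \<Rightarrow> 'v) \<Rightarrow> (complex mat \<Rightarrow> complex) \<Rightarrow> bool" where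
  "simple_highest_weight_module n scale \<rho> \<Lambda> \<longleftrightarrow>
     sl_rep n scale \<rho> \<and> acts_irreducibly scale \<rho> (sl n) UNIV \<and>
     has_highest_weight n scale \<rho> \<Lambda>"

definition free_act :: "(complex \<Rightarrow> 'v::ab_group_add \<Rightarrow> 'v) \<Rightarrow> ('x \<Rightarrow> 'v \<Rightarrow> 'v) \<Rightarrow>
    ('x list \<Rightarrow> complex) \<Rightarrow> 'v \<Rightarrow> 'v" where
  "free_act scale \<rho> a v = (\<Sum>w | a w \<noteq> 0. scale (a w) (foldr \<rho> w v))"

text \<open>
  An element of \<open>U(sl n)\<close> is a coset of elements of the free algebra, all of which act in the
  same way (lemma \<open>env_act_coset\<close> below).
\<close>

definition env_act :: "(complex \<Rightarrow> 'v::ab_group_add \<Rightarrow> 'v) \<Rightarrow> (complex mat \<Rightarrow> 'v \<Rightarrow> 'v) \<Rightarrow>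
    (complex mat list \<Rightarrow> complex) set \<Rightarrow> 'v \<Rightarrow> 'v" where
  "env_act scale \<rho> u v = the_elem ((\<lambda>a. free_act scale \<rho> a v) ` u)"

context sl_rep
begin

lemma free_act_alt:
  assumes "finite A" "{w. a w \<noteq> 0} \<subseteq> A"
  shows "free_act scale \<rho> a v = (\<Sum>w\<in>A. scale (a w) (foldr \<rho> w v))"
  unfolding free_act_def using assms by (intro sum.mono_neutral_left) auto

lemma free_act_add:
  assumes "a \<in> carrier (free_algebra S)" "b \<in> carrier (free_algebra S)"
  shows "free_act scale \<rho> (\<lambda>w. a w + b w) v = free_act scale \<rho> a v + free_act scale \<rho> b v"
proof -
  let ?A = "{w. a w \<noteq> 0} \<union> {w. b w \<noteq> 0}"
  have "finite ?A" using assms by (simp add: free_algebra_def)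
  then show ?thesis
    by (subst (1 2 3) free_act_alt[of ?A]) (auto simp: scale_left_distrib sum.distrib)
qed

lemma free_act_diff:
  assumes "a \<in> carrier (free_algebra S)" "b \<in> carrier (free_algebra S)"
  shows "free_act scale \<rho> (\<lambda>w. a w - b w) v = free_act scale \<rho> a v - free_act scale \<rho> b v"
proof -
  let ?A = "{w. a w \<noteq> 0} \<union> {w. b w \<noteq> 0}"
  have "finite ?A" using assms by (simp add: free_algebra_def)
  then show ?thesis
    by (subst (1 2 3) free_act_alt[of ?A]) (auto simp: scale_left_diff_distrib sum_subtractf)
qed

lemma free_act_word: "free_act scale \<rho> (free_word a u) v = scale a (foldr \<rho> u v)"
  by (subst free_act_alt[of "{u}"]) (auto simp: free_word_def)

lemma foldr_linear: "w \<in> lists (sl n) \<Longrightarrow> Vector_Spaces.linear scale scale (foldr \<rho> w)"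
proof (induction w)
  case Nil
  then show ?case using linear_id by (simp add: id_def)
next
  case (Cons X w)
  then show ?case
    using Vector_Spaces.linear_compose[of scale scale "foldr \<rho> w" scale "\<rho> X"] linear_rep[of X]
    by (simp add: comp_def)
qed

lemma free_act_mult:
  assumes a: "a \<in> carrier (free_algebra (sl n))" and b: "b \<in> carrier (free_algebra (sl n))"
  shows "free_act scale \<rho> (a \<otimes>\<^bsub>free_algebra (sl n)\<^esub> b) v =
         free_act scale \<rho> a (free_act scale \<rho> b v)"
proof -
  let ?A = "{w. a w \<noteq> 0}" and ?B = "{w. b w \<noteq> 0}"
  let ?P = "?A \<times> ?B"
  let ?g = "\<lambda>(u, v). u @ v"
  have fin: "finite ?A" "finite ?B" "finite ?P" and sub: "?A \<subseteq> lists (sl n)"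
    using a b by (auto simp: free_algebra_def)
  have mult: "(a \<otimes>\<^bsub>free_algebra (sl n)\<^esub> b) w = (\<Sum>(s, t) | s @ t = w. a s * b t)" for w
    by (simp add: free_algebra_def)
  have mult': "(a \<otimes>\<^bsub>free_algebra (sl n)\<^esub> b) w =
      (\<Sum>p\<in>{p \<in> ?P. ?g p = w}. a (fst p) * b (snd p))" for w
    unfolding mult case_prod_beta
    by (rule sum.mono_neutral_right) (auto simp: finite_splits[unfolded case_prod_beta] case_prod_beta)
  have "free_act scale \<rho> (a \<otimes>\<^bsub>free_algebra (sl n)\<^esub> b) v =
    (\<Sum>w\<in>?g ` ?P. scale ((a \<otimes>\<^bsub>free_algebra (sl n)\<^esub> b) w) (foldr \<rho> w v))"
    using fin free_mult_supp[of a b] by (intro free_act_alt) (auto simp: mult)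
  also have "\<dots> = (\<Sum>w\<in>?g ` ?P. \<Sum>p\<in>{p \<in> ?P. ?g p = w}.
      scale (a (fst p) * b (snd p)) (foldr \<rho> (fst p @ snd p) v))"
    unfolding mult' scale_sum_left by (intro sum.cong refl) auto
  also have "\<dots> = (\<Sum>p\<in>?P. scale (a (fst p) * b (snd p)) (foldr \<rho> (fst p @ snd p) v))"
    using fin(3) by (rule sum.image_gen[symmetric])
  also have "\<dots> = (\<Sum>s\<in>?A. \<Sum>t\<in>?B. scale (a s * b t) (foldr \<rho> (s @ t) v))"
    by (simp add: sum.cartesian_product case_prod_beta)
  also have "\<dots> = (\<Sum>s\<in>?A. scale (a s) (foldr \<rho> s (\<Sum>t\<in>?B. scale (b t) (foldr \<rho> t v))))"
  proof (rule sum.cong[OF refl])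
    fix s assume "s \<in> ?A"
    then interpret s: Vector_Spaces.linear scale scale "foldr \<rho> s"
      using sub foldr_linear by blast
    show "(\<Sum>t\<in>?B. scale (a s * b t) (foldr \<rho> (s @ t) v)) =
        scale (a s) (foldr \<rho> s (\<Sum>t\<in>?B. scale (b t) (foldr \<rho> t v)))"
      by (simp add: s.sum s.scale scale_sum_right)
  qed
  finally show ?thesis by (simp add: free_act_def)
qed

lemma env_ideal_acts_zero:
  assumes "a \<in> env_ideal n" shows "free_act scale \<rho> a v = 0"
proof -
  interpret F: ring "free_algebra (sl n)" by (rule ring_free_algebra)
  let ?K = "{a \<in> carrier (free_algebra (sl n)). \<forall>v. free_act scale \<rho> a v = 0}"
  have zero: "free_act scale \<rho> a 0 = 0" if "a \<in> carrier (free_algebra (sl n))" for a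
  proof -
    have "foldr \<rho> w 0 = 0" if "a w \<noteq> 0" for w
    proof -
      have "w \<in> lists (sl n)"
        using \<open>a \<in> _\<close> that by (auto simp: free_algebra_def)
      then interpret w: Vector_Spaces.linear scale scale "foldr \<rho> w"
        by (rule foldr_linear)
      show ?thesis by (rule w.zero)
    qed
    then show ?thesis by (simp add: free_act_def)
  qed
  have add: "(\<oplus>\<^bsub>free_algebra (sl n)\<^esub>) = (\<lambda>a b w. a w + b w)"
    and z: "\<zero>\<^bsub>free_algebra (sl n)\<^esub> = (\<lambda>w. 0)"
    by (auto simp: free_algebra_def)
  have actz: "free_act scale \<rho> (\<lambda>w. 0) v = 0" for v
    by (simp add: free_act_def)
  have "ideal ?K (free_algebra (sl n))"
  proof (rule idealI)
    show "subgroup ?K (add_monoid (free_algebra (sl n)))"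
    proof (rule subgroup.intro)
      fix x assume x: "x \<in> ?K"
      let ?y = "\<ominus>\<^bsub>free_algebra (sl n)\<^esub> x"
      have y: "?y \<in> carrier (free_algebra (sl n))" using x by simp
      have "x \<oplus>\<^bsub>free_algebra (sl n)\<^esub> ?y = \<zero>\<^bsub>free_algebra (sl n)\<^esub>" using x F.r_neg by blast
      then have "(\<lambda>w. x w + ?y w) = (\<lambda>w. 0)" unfolding add z .
      then have "free_act scale \<rho> x v + free_act scale \<rho> ?y v = 0" for v
        using free_act_add[of x "sl n" ?y v] x y actz by auto
      then show "inv\<^bsub>add_monoid (free_algebra (sl n))\<^esub> x \<in> ?K"
        using x y by (auto simp: a_inv_def)
    next
      fix x y assume x: "x \<in> ?K" and y: "y \<in> ?K"
      then have "x \<oplus>\<^bsub>free_algebra (sl n)\<^esub> y \<in> carrier (free_algebra (sl n))" by simp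
      then show "x \<otimes>\<^bsub>add_monoid (free_algebra (sl n))\<^esub> y \<in> ?K"
        using x y free_act_add[of x "sl n" y] by (auto simp: add)
    next
      show "\<one>\<^bsub>add_monoid (free_algebra (sl n))\<^esub> \<in> ?K"
        using F.zero_closed by (auto simp: z actz)
    qed auto
  qed (auto simp: free_act_mult zero ring_free_algebra)
  moreover have "env_relations n \<subseteq> ?K"
  proof
    fix r assume r: "r \<in> env_relations n"
    have C: "free_word a w \<in> carrier (free_algebra (sl n))" if "set w \<subseteq> sl n" for a w
      using that by (intro free_word_carrier) auto
    have "free_act scale \<rho> r v = 0" for v
      using r unfolding env_relations_def
    proof (elim UnE CollectE exE conjE)
      fix a b X Y
      assume req: "r = (\<lambda>w. free_word 1 [a \<cdot>\<^sub>m X + b \<cdot>\<^sub>m Y] w - free_word a [X] w - free_word b [Y] w)"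
        and X: "X \<in> sl n" and Y: "Y \<in> sl n"
      have aX: "a \<cdot>\<^sub>m X \<in> sl n" and bY: "b \<cdot>\<^sub>m Y \<in> sl n"
        using X Y by (auto simp: sl_def simp flip: sum_distrib_left)
      have c: "free_word 1 [a \<cdot>\<^sub>m X + b \<cdot>\<^sub>m Y] \<in> carrier (free_algebra (sl n))"
        "free_word a [X] \<in> carrier (free_algebra (sl n))"
        "free_word b [Y] \<in> carrier (free_algebra (sl n))"
        using X Y sl_lincomb by (auto intro!: C)
      show ?thesis
        unfolding req free_act_diff[OF free_diff_carrier[OF c(1,2)] c(3)] free_act_diff[OF c(1,2)]
        by (simp add: free_act_word rep_add[OF aX bY] rep_smult X Y)
    next
      fix X Y
      assume req: "r = (\<lambda>w. free_word 1 [X, Y] w - free_word 1 [Y, X] w - free_word 1 [lie_bracket X Y] w)"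
        and X: "X \<in> sl n" and Y: "Y \<in> sl n"
      have c: "free_word 1 [X, Y] \<in> carrier (free_algebra (sl n))"
        "free_word 1 [Y, X] \<in> carrier (free_algebra (sl n))"
        "free_word 1 [lie_bracket X Y] \<in> carrier (free_algebra (sl n))"
        using X Y sl_bracket by (auto intro!: C)
      show ?thesis
        unfolding req free_act_diff[OF free_diff_carrier[OF c(1,2)] c(3)] free_act_diff[OF c(1,2)]
        by (simp add: free_act_word rep_bracket X Y)
    qed
    then show "r \<in> ?K" using r env_relations_carrier by auto
  qed
  ultimately have "env_ideal n \<subseteq> ?K"
    unfolding env_ideal_def by (rule F.genideal_minimal)
  then show ?thesis using assms by auto
qed

lemma env_act_coset:
  assumes a: "a \<in> carrier (free_algebra (sl n))"
  shows "env_act scale \<rho> (env_ideal n +>\<^bsub>free_algebra (sl n)\<^esub> a) v = free_act scale \<rho> a v"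
proof -
  interpret I: ideal "env_ideal n" "free_algebra (sl n)" by (rule ideal_env_ideal)
  have act: "free_act scale \<rho> (\<lambda>w. i w + a w) v = free_act scale \<rho> a v"
    if i: "i \<in> env_ideal n" for i
  proof -
    have "i \<in> carrier (free_algebra (sl n))" using i I.a_subset by blast
    then show ?thesis using free_act_add[OF _ a] env_ideal_acts_zero[OF i] by simp
  qed
  have "env_ideal n +>\<^bsub>free_algebra (sl n)\<^esub> a = (\<lambda>i w. i w + a w) ` env_ideal n"
    unfolding a_r_coset_def' by (simp add: free_algebra_def UNION_singleton_eq_range)
  moreover have "env_ideal n \<noteq> {}" using additive_subgroup.zero_closed[OF I.is_additive_subgroup] by blast
  ultimately have "(\<lambda>a. free_act scale \<rho> a v) ` (env_ideal n +>\<^bsub>free_algebra (sl n)\<^esub> a) =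
      {free_act scale \<rho> a v}"
    by (simp add: image_image act image_constant_conv cong: image_cong)
  then show ?thesis by (simp add: env_act_def)
qed

end

end

theory Submission
  imports Defs
begin

text \<open>
  Let \<open>V\<close> be the simple module and let \<open>E i j\<close> be the action of the matrix units of \<open>gl n\<close>, where
  the identity matrix acts by \<open>p - q\<close>, so that the highest weight is exactly \<open>(p, 0, \<dots>, 0, -q)\<close>.
  Fix a nonzero subspace \<open>S\<close> of a weight space that is stable under the Casimir algebra, and
  \<open>s \<noteq> 0\<close> in \<open>S\<close>.  As \<open>V\<close> is simple, the words in the \<open>E i j\<close> applied to \<open>s\<close> span \<open>V\<close>; each such
  vector is a weight vector, so the weight space itself is spanned by the balanced words, those in
  which every index occurs as often as a row as it does as a column
  (\<open>weight_vector_in_S\<close>).  It is therefore enough that balanced words preserve \<open>S\<close>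
  (\<open>stabilizes_balanced\<close>).

  This is proved by induction on the length of the word.  Modulo shorter balanced words the letters
  commute, and a balanced word, read as a multiset of edges of a directed graph, is a union of
  closed walks.  A union of several closed walks is handled by induction, so a single closed walk
  \<open>E x1 x2, E x2 x3, \<dots>, E xk x1\<close> remains.

  What makes the weights \<open>(p, 0, \<dots>, 0, -q)\<close> special is that the 3 by 3 minors of the matrix
  \<open>(E i j)\<close>, with Capelli's shifts of the diagonal, act by zero on \<open>V\<close> (\<open>minor_eq_0\<close>): a principal
  minor on rows \<open>i < j < k\<close> acts on the highest weight vector by \<open>(l i + 1) * l j * (l k - 1)\<close>,
  where \<open>l\<close> is the highest weight, and \<open>l j = 0\<close>.  Classically this says that \<open>(E i j)\<close> has rank at
  most two, and the following is the fundamental trace identity of 2 by 2 matrices.  Multiplying a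
  minor by suitable further letters shows that a closed walk composed of three blocks changes its sign,
  modulo products of closed walks and shorter words, when two blocks are exchanged (\<open>block_swap\<close>).
  With four vertices or more the same exchange can be made in ways with different signs, so twice
  the walk is decomposable.  The same relation makes the sum of a walk with three vertices and its
  reverse decomposable, while their difference is, up to a factor, a commutator of two Casimir
  elements.  A walk with two vertices is, up to a Cartan element, half a Casimir element.
\<close>

section \<open>Components of a vector along eigenvectors\<close>

context vector_space
begin

text \<open>
  If some \<open>y\<close> in a linear combination has an eigenvalue \<open>\<alpha> \<noteq> a\<close>, then \<open>(A - \<alpha>) / (a - \<alpha>)\<close> fixes \<open>x\<close>,
  removes \<open>y\<close> and only rescales the other terms.
\<close>

lemma eigenvector_in_span:
  assumes A: "Vector_Spaces.linear scale scale A"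
    and x: "x \<in> span B"
    and B: "\<And>b. b \<in> B \<Longrightarrow> \<exists>\<alpha>. A b = scale \<alpha> b"
    and Ax: "A x = scale a x"
  shows "x \<in> span {b \<in> B. A b = scale a b}"
proof -
  interpret A: Vector_Spaces.linear scale scale A by fact
  obtain \<alpha> where \<alpha>: "\<And>b. b \<in> B \<Longrightarrow> A b = scale (\<alpha> b) b"
    using B by metis
  have "x = (\<Sum>b\<in>t. scale (r b) b) \<Longrightarrow> finite t \<Longrightarrow> t \<subseteq> B \<Longrightarrow> ?thesis" for t r
  proof (induction "card {b \<in> t. A b \<noteq> scale a b}" arbitrary: t r rule: less_induct)
    case less
    show ?case
    proof (cases "{b \<in> t. A b \<noteq> scale a b} = {}")
      case True
      with less.prems show ?thesis
        by (subst less.prems(1)) (intro span_sum span_scale span_base, blast)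
    next
      case False
      then obtain y where y: "y \<in> t" "A y \<noteq> scale a y" by blast
      with less.prems \<alpha> have ne: "a - \<alpha> y \<noteq> 0" by fastforce
      let ?r = "\<lambda>b. r b * (\<alpha> b - \<alpha> y) / (a - \<alpha> y)"
      have "scale (a - \<alpha> y) x = A x - scale (\<alpha> y) x"
        by (simp add: Ax scale_left_diff_distrib)
      also have "\<dots> = (\<Sum>b\<in>t. scale (r b * (\<alpha> b - \<alpha> y)) b)"
        using less.prems \<alpha>
        by (auto simp: A.sum A.scale scale_sum_right subset_iff algebra_simps
            simp flip: sum_subtractf intro!: sum.cong)
      also have "\<dots> = scale (a - \<alpha> y) (\<Sum>b\<in>t. scale (?r b) b)"
        using ne by (simp add: scale_sum_right)
      finally have "x = (\<Sum>b\<in>t. scale (?r b) b)"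
        using ne by simp
      also have "\<dots> = (\<Sum>b\<in>t - {y}. scale (?r b) b)"
        using less.prems(2) by (intro sum.mono_neutral_right) auto
      finally have "x = (\<Sum>b\<in>t - {y}. scale (?r b) b)" .
      moreover have "card {b \<in> t - {y}. A b \<noteq> scale a b} < card {b \<in> t. A b \<noteq> scale a b}"
        using less.prems(2) y by (intro psubset_card_mono) auto
      ultimately show ?thesis
        using less.prems(2,3) by (intro less.hyps[of "t - {y}" "\<lambda>b. r b * (\<alpha> b - \<alpha> y) / (a - \<alpha> y)"]) auto
    qed
  qed
  with x show ?thesis
    unfolding span_explicit by blast
qed

end

section \<open>Capelli minors\<close>

text \<open>
  A representation of \<open>gl n\<close>, given by the action \<open>E i j\<close> of the matrix units.
\<close>

locale gl_rep = vector_space scale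
  for scale :: "'k::field_char_0 \<Rightarrow> 'v::ab_group_add \<Rightarrow> 'v" +
  fixes n :: nat and E :: "nat \<Rightarrow> nat \<Rightarrow> 'v \<Rightarrow> 'v"
  assumes linear_E: "i < n \<Longrightarrow> j < n \<Longrightarrow> Vector_Spaces.linear scale scale (E i j)"
    and E_comm: "i < n \<Longrightarrow> j < n \<Longrightarrow> k < n \<Longrightarrow> l < n \<Longrightarrow> E i j (E k l v) =
      E k l (E i j v) + (if j = k then E i l v else 0) - (if l = i then E k j v else 0)"
begin

lemma
  assumes "i < n" "j < n"
  shows E_add: "E i j (x + y) = E i j x + E i j y"
    and E_diff: "E i j (x - y) = E i j x - E i j y"
    and E_scale: "E i j (scale a x) = scale a (E i j x)"
    and E_zero: "E i j 0 = 0"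
    and E_uminus: "E i j (- x) = - E i j x"
proof -
  interpret F: Vector_Spaces.linear scale scale "E i j" using assms by (rule linear_E)
  show "E i j (x + y) = E i j x + E i j y" "E i j (x - y) = E i j x - E i j y"
    "E i j (scale a x) = scale a (E i j x)" "E i j 0 = 0" "E i j (- x) = - E i j x"
    by (simp_all add: F.add F.diff F.scale F.neg)
qed

lemmas E_linear_simps = E_add E_diff E_scale E_zero E_uminus

text \<open>
  A Capelli minor is a determinant of matrix units whose factors carry the diagonal shifts \<open>1\<close>, \<open>0\<close>
  and \<open>-1\<close> from left to right.  It is antisymmetric in the rows by its definition; the shifts
  make it antisymmetric in the columns too.
\<close>

definition shifted :: "'k \<Rightarrow> nat \<Rightarrow> nat \<Rightarrow> 'v \<Rightarrow> 'v" where
  "shifted c i j v = E i j v + (if i = j then scale c v else 0)"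

lemma
  assumes "i < n" "j < n"
  shows shifted_add: "shifted c i j (x + y) = shifted c i j x + shifted c i j y"
    and shifted_diff: "shifted c i j (x - y) = shifted c i j x - shifted c i j y"
    and shifted_scale: "shifted c i j (scale r x) = scale r (shifted c i j x)"
    and shifted_zero: "shifted c i j 0 = 0"
  using assms by (auto simp: shifted_def E_linear_simps algebra_simps)

lemma E_shifted:
  assumes "a < n" "b < n" "i < n" "j < n"
  shows "E a b (shifted c i j v) =
    shifted c i j (E a b v) + (if b = i then shifted c a j v else 0) - (if a = j then shifted c i b v else 0)"
  using assms by (auto simp: shifted_def E_linear_simps E_comm[of a b i j])

definition minor_term :: "nat \<Rightarrow> nat \<Rightarrow> nat \<Rightarrow> nat \<Rightarrow> nat \<Rightarrow> nat \<Rightarrow> 'v \<Rightarrow> 'v" where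
  "minor_term i j k a b c v = shifted 1 i a (shifted 0 j b (shifted (-1) k c v))"

definition minor :: "nat \<Rightarrow> nat \<Rightarrow> nat \<Rightarrow> nat \<Rightarrow> nat \<Rightarrow> nat \<Rightarrow> 'v \<Rightarrow> 'v" where
  "minor i j k a b c v =
     minor_term i j k a b c v + minor_term j k i a b c v + minor_term k i j a b c v
     - minor_term j i k a b c v - minor_term i k j a b c v - minor_term k j i a b c v"

lemma shifted_if:
  assumes "i < n" "j < n"
  shows "shifted c i j (if P then x else 0) = (if P then shifted c i j x else 0)"
  using assms by (simp add: shifted_zero)

text \<open>
  Commuting with \<open>E p q\<close> is a derivation which acts on each index of a factor as on a tensor; the
  shifts are multiples of the invariant tensor \<open>\<delta>\<close> and do not disturb this.  So the
  span of the minors is stable under commutators with units.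
\<close>

lemma E_minor_term:
  assumes "p < n" "q < n" "i < n" "j < n" "k < n" "a < n" "b < n" "c < n"
  shows "E p q (minor_term i j k a b c v) = minor_term i j k a b c (E p q v)
    + (if q = i then minor_term p j k a b c v else 0) + (if q = j then minor_term i p k a b c v else 0)
    + (if q = k then minor_term i j p a b c v else 0) - (if p = a then minor_term i j k q b c v else 0)
    - (if p = b then minor_term i j k a q c v else 0) - (if p = c then minor_term i j k a b q v else 0)"
  using assms by (simp add: minor_term_def E_shifted shifted_add shifted_diff shifted_if)

lemma if_add_zero: "(if P then x + y else 0) = (if P then x else 0) + (if P then y else (0::'v))"
  by simp

lemma if_diff_zero: "(if P then x - y else 0) = (if P then x else 0) - (if P then y else (0::'v))"
  by simp

lemma E_minor:
  assumes "p < n" "q < n" "i < n" "j < n" "k < n" "a < n" "b < n" "c < n"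
  shows "E p q (minor i j k a b c v) = minor i j k a b c (E p q v)
    + (if q = i then minor p j k a b c v else 0) + (if q = j then minor i p k a b c v else 0)
    + (if q = k then minor i j p a b c v else 0) - (if p = a then minor i j k q b c v else 0)
    - (if p = b then minor i j k a q c v else 0) - (if p = c then minor i j k a b q v else 0)"
  using assms unfolding minor_def
  by (simp only: E_minor_term E_add E_diff if_add_zero if_diff_zero) (simp only: algebra_simps)

lemma
  assumes "i < n" "j < n" "k < n" "a < n" "b < n" "c < n"
  shows minor_add: "minor i j k a b c (x + y) = minor i j k a b c x + minor i j k a b c y"
    and minor_scale: "minor i j k a b c (scale r x) = scale r (minor i j k a b c x)"
    and minor_zero: "minor i j k a b c 0 = 0"
  using assms
  by (simp_all add: minor_def minor_term_def shifted_add shifted_scale shifted_zero scale_right_diff_distrib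
      scale_right_distrib)

text \<open>
  The commutators that arise when the two factors exchange their columns are cancelled exactly
  when the shift decreases by one from a factor to the next.
\<close>

lemma shifted_swap:
  assumes "i < n" "j < n" "a < n" "b < n"
  shows "shifted (c + 1) i a (shifted c j b v) - shifted (c + 1) j a (shifted c i b v) =
     shifted (c + 1) j b (shifted c i a v) - shifted (c + 1) i b (shifted c j a v)"
proof -
  have E_if: "E k l (if P then x else 0) = (if P then E k l x else 0)" if "k < n" "l < n" for k l P x
    using that by (simp add: E_zero)
  show ?thesis
    using assms
    by (simp add: shifted_def E_linear_simps E_if E_comm[of i a j b v] E_comm[of i b j a v]
        split del: if_split) (simp add: E_linear_simps algebra_simps)
qed

lemma minor_swap_rows:
  "minor j i k a b c v = - minor i j k a b c v"
  "minor i k j a b c v = - minor i j k a b c v"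
  by (simp_all add: minor_def)

lemma minor_swap_cols:
  assumes "i < n" "j < n" "k < n" "a < n" "b < n" "c < n"
  shows "minor i j k b a c v = - minor i j k a b c v"
    and "minor i j k a c b v = - minor i j k a b c v"
proof -
  have 1: "minor_term i j k a b c v - minor_term j i k a b c v = minor_term j i k b a c v - minor_term i j k b a c v"
    if "i < n" "j < n" "k < n" for i j k
    using shifted_swap[of i j a b 0 "shifted (-1) k c v"] assms that by (simp add: minor_term_def)
  have 2: "minor_term k i j a b c v - minor_term k j i a b c v = minor_term k j i a c b v - minor_term k i j a c b v"
    if "i < n" "j < n" "k < n" for i j k
    using shifted_swap[of i j b c "-1" v] assms that
    by (simp add: minor_term_def flip: shifted_diff)
  show "minor i j k b a c v = - minor i j k a b c v"
    using 1[of i j k] 1[of j k i] 1[of k i j] assms by (simp add: minor_def algebra_simps)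
  show "minor i j k a c b v = - minor i j k a b c v"
    using 2[of i j k] 2[of j k i] 2[of k i j] assms by (simp add: minor_def algebra_simps)
qed

section \<open>Words, weights and heights\<close>

definition word_op :: "(nat \<times> nat) list \<Rightarrow> 'v \<Rightarrow> 'v" where
  "word_op w = foldr (\<lambda>(i, j). E i j) w"

lemma word_Nil [simp]: "word_op [] v = v"
  and word_Cons [simp]: "word_op ((i, j) # w) v = E i j (word_op w v)"
  and word_append: "word_op (u @ w) v = word_op u (word_op w v)"
  by (simp_all add: word_op_def)

abbreviation letters :: "(nat \<times> nat) set" where
  "letters \<equiv> {..<n} \<times> {..<n}"

lemma
  assumes "w \<in> lists letters"
  shows word_diff: "word_op w (x - y) = word_op w x - word_op w y"
    and word_zero: "word_op w 0 = 0"
  using assms by (induction w) (auto simp: E_linear_simps)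

definition invariant :: "'v set \<Rightarrow> bool" where
  "invariant S \<longleftrightarrow> subspace S \<and> (\<forall>i<n. \<forall>j<n. \<forall>v\<in>S. E i j v \<in> S)"

lemma span_E_closed:
  assumes "i < n" "j < n" "\<And>b. b \<in> B \<Longrightarrow> E i j b \<in> span B'" "x \<in> span B"
  shows "E i j x \<in> span B'"
  using assms(4)
  by (induction rule: span_induct_alt)
    (use assms in \<open>auto simp: E_linear_simps intro!: span_add span_scale span_zero\<close>)

lemma invariant_span_words: "invariant (span ((\<lambda>w. word_op w v) ` lists letters))"
  unfolding invariant_def
proof (intro conjI allI impI ballI)
  fix i j x assume ij: "i < n" "j < n" and x: "x \<in> span ((\<lambda>w. word_op w v) ` lists letters)"
  show "E i j x \<in> span ((\<lambda>w. word_op w v) ` lists letters)"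
  proof (rule span_E_closed[OF ij _ x])
    fix b assume "b \<in> (\<lambda>w. word_op w v) ` lists letters"
    then obtain w where "w \<in> lists letters" "b = word_op w v" by blast
    then have "E i j b = word_op ((i, j) # w) v" "(i, j) # w \<in> lists letters"
      using ij by auto
    then show "E i j b \<in> span ((\<lambda>w. word_op w v) ` lists letters)"
      by (intro span_base image_eqI[of _ _ "(i, j) # w"])
  qed
qed simp

abbreviation lowering :: "(nat \<times> nat) set" where
  "lowering \<equiv> {(i, j). j < i \<and> i < n}"

lemma lowering_letters: "w \<in> lists lowering \<Longrightarrow> w \<in> lists letters"
  by (induction w) auto

definition is_weight_vector :: "(nat \<Rightarrow> 'k) \<Rightarrow> 'v \<Rightarrow> bool" where
  "is_weight_vector l v \<longleftrightarrow> (\<forall>i<n. E i i v = scale (l i) v)"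

definition primitive :: "'v \<Rightarrow> bool" where
  "primitive v \<longleftrightarrow> (\<forall>i j. i < j \<longrightarrow> j < n \<longrightarrow> E i j v = 0)"

text \<open>
  A unit applied to a lowering word is moved to the right, letter by letter: the commutators are
  units applied to a shorter lowering word, and on \<open>v\<close> itself raising units vanish and diagonal units
  are scalars.
\<close>

lemma invariant_span_lowering:
  assumes wt: "is_weight_vector l v" and prim: "primitive v"
  shows "invariant (span ((\<lambda>w. word_op w v) ` lists lowering))" (is "invariant (span ?L)")
proof -
  have low: "E i j x \<in> span ?L" if "(i, j) \<in> lowering" "x \<in> span ?L" for i j x
  proof (rule span_E_closed[OF _ _ _ that(2)])
    fix b assume "b \<in> ?L"
    then obtain w where "w \<in> lists lowering" "b = word_op w v" by blast
    then have "E i j b = word_op ((i, j) # w) v" "(i, j) # w \<in> lists lowering"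
      using that by auto
    then show "E i j b \<in> span ?L" by (intro span_base image_eqI[of _ _ "(i, j) # w"])
  qed (use that in auto)
  have "\<forall>a<n. \<forall>b<n. E a b (word_op w v) \<in> span ?L" if "w \<in> lists lowering" for w
    using that
  proof (induction w)
    case Nil
    have v: "v \<in> span ?L" by (intro span_base image_eqI[of _ _ "[]"]) auto
    have "E a b v \<in> span ?L" if "a < n" "b < n" for a b
    proof (cases a b rule: linorder_cases)
      case less
      with prim that show ?thesis by (simp add: primitive_def span_zero)
    next
      case equal
      with wt that v show ?thesis by (simp add: is_weight_vector_def span_scale)
    next
      case greater
      with that v show ?thesis by (intro low) auto
    qed
    then show ?case by simp
  next
    case (Cons x w)
    obtain i j where x: "x = (i, j)" by fastforce
    show ?case
    proof (intro allI impI)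
      fix a b assume ab: "a < n" "b < n"
      have ij: "j < i" "i < n" using Cons.hyps x by auto
      have IH: "E a b (word_op w v) \<in> span ?L" if "a < n" "b < n" for a b
        using Cons.IH that by blast
      have "E a b (E i j (word_op w v)) \<in> span ?L"
        using ab ij by (subst E_comm) (auto intro!: span_add span_diff low IH span_zero)
      then show "E a b (word_op (x # w) v) \<in> span ?L" by (simp add: x)
    qed
  qed
  then have "E i j b \<in> span ?L" if "i < n" "j < n" "b \<in> ?L" for i j b
    using that by blast
  then show ?thesis
    unfolding invariant_def by (blast intro: span_E_closed subspace_span)
qed

text \<open>
  The diagonal element \<open>\<Sum> i * E i i\<close> grades the module: a letter \<open>E i j\<close> changes its eigenvalue by
  \<open>i - j\<close>, which is positive for lowering letters.
\<close>

definition height_op :: "'v \<Rightarrow> 'v" where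
  "height_op v = (\<Sum>i<n. scale (of_nat i) (E i i v))"

lemma linear_height_op: "Vector_Spaces.linear scale scale height_op"
  unfolding height_op_def[abs_def]
  by unfold_locales (auto simp: E_linear_simps sum.distrib algebra_simps scale_sum_right)

lemma height_op_E:
  assumes "i < n" "j < n"
  shows "height_op (E i j v) = E i j (height_op v) + scale (of_nat i - of_nat j) (E i j v)"
proof -
  interpret F: Vector_Spaces.linear scale scale "E i j" using assms by (rule linear_E)
  have "height_op (E i j v) = (\<Sum>k<n. scale (of_nat k) (E i j (E k k v))
      + (if k = i then scale (of_nat i) (E i j v) else 0) - (if k = j then scale (of_nat j) (E i j v) else 0))"
    unfolding height_op_def using assms
    by (intro sum.cong) (auto simp: E_comm[of _ _ i j] algebra_simps)
  also have "\<dots> = E i j (height_op v) + scale (of_nat i) (E i j v) - scale (of_nat j) (E i j v)"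
    using assms by (simp add: sum.distrib sum_subtractf height_op_def F.sum F.scale)
  finally show ?thesis by (simp add: algebra_simps)
qed

definition height :: "(nat \<times> nat) list \<Rightarrow> int" where
  "height w = (\<Sum>(i, j)\<leftarrow>w. int i - int j)"

lemma height_op_word:
  assumes "w \<in> lists letters" "height_op v = scale d v"
  shows "height_op (word_op w v) = scale (d + of_int (height w)) (word_op w v)"
  using assms(1)
  by (induction w) (auto simp: assms height_def height_op_E E_linear_simps algebra_simps)

lemma height_lowering_pos: "w \<in> lists lowering \<Longrightarrow> w \<noteq> [] \<Longrightarrow> height w > 0"
  by (induction w) (auto simp: height_def, fastforce)

lemma weight_height_op:
  assumes "is_weight_vector l v"
  shows "height_op v = scale (\<Sum>i<n. of_nat i * l i) v"
  using assms by (simp add: height_op_def is_weight_vector_def scale_sum_left)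

lemma weight_E:
  assumes "is_weight_vector l v" "i < n" "j < n"
  shows "is_weight_vector (\<lambda>k. l k + of_bool (k = i) - of_bool (k = j)) (E i j v)"
  using assms unfolding is_weight_vector_def
  by (auto simp: E_comm[of _ _ i j] E_linear_simps algebra_simps)

lemma
  assumes "is_weight_vector l x" "is_weight_vector l y"
  shows weight_add: "is_weight_vector l (x + y)"
    and weight_diff: "is_weight_vector l (x - y)"
    and weight_scale: "is_weight_vector l (scale c x)"
  using assms by (auto simp: is_weight_vector_def E_linear_simps algebra_simps)

lemma weight_shifted:
  assumes "is_weight_vector l v" "i < n" "j < n"
  shows "is_weight_vector (\<lambda>k. l k + of_bool (k = i) - of_bool (k = j)) (shifted c i j v)"
proof (cases "i = j")
  case True
  with weight_E[OF assms] assms(1) show ?thesis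
    by (simp add: shifted_def weight_add weight_scale)
qed (use weight_E[OF assms] in \<open>simp add: shifted_def\<close>)

lemma weight_minor:
  assumes l: "is_weight_vector l v" and ind: "i < n" "j < n" "k < n" "a < n" "b < n" "c < n"
  shows "is_weight_vector (\<lambda>m. l m + of_bool (m = i) + of_bool (m = j) + of_bool (m = k)
     - of_bool (m = a) - of_bool (m = b) - of_bool (m = c)) (minor i j k a b c v)" (is "is_weight_vector ?l _")
proof -
  have summand: "is_weight_vector ?l (minor_term r s t a b c v)"
    if "{#r, s, t#} = {#i, j, k#}" "r < n" "s < n" "t < n" for r s t
  proof -
    have *: "of_bool (m = r) + of_bool (m = s) + of_bool (m = t) =
      (of_bool (m = i) + of_bool (m = j) + of_bool (m = k) :: 'k)" for m
      using that(1) by (auto simp: add_eq_conv_ex add_mset_eq_single)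
    have "is_weight_vector (\<lambda>m. l m + of_bool (m = t) - of_bool (m = c) + of_bool (m = s)
        - of_bool (m = b) + of_bool (m = r) - of_bool (m = a)) (minor_term r s t a b c v)"
      unfolding minor_term_def using that ind l by (intro weight_shifted)
    also have "(\<lambda>m. l m + of_bool (m = t) - of_bool (m = c) + of_bool (m = s)
        - of_bool (m = b) + of_bool (m = r) - of_bool (m = a)) =
      (\<lambda>m. l m + (of_bool (m = r) + of_bool (m = s) + of_bool (m = t))
        - of_bool (m = a) - of_bool (m = b) - of_bool (m = c))"
      by (simp add: fun_eq_iff algebra_simps)
    also have "\<dots> = ?l"
      unfolding * by (simp add: fun_eq_iff algebra_simps)
    finally show ?thesis .
  qed
  show ?thesis
    unfolding minor_def using ind by (intro weight_add weight_diff summand) (auto simp: add_mset_commute)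
qed

lemma weight_word:
  assumes "is_weight_vector l v" "w \<in> lists letters"
  shows "is_weight_vector (\<lambda>k. l k + of_nat (count (mset (map fst w)) k)
     - of_nat (count (mset (map snd w)) k)) (word_op w v)"
  using assms(2)
proof (induction w)
  case Nil
  with assms(1) show ?case by simp
next
  case (Cons x w)
  obtain i j where x: "x = (i, j)" by fastforce
  with Cons have "i < n" "j < n" by auto
  note step = weight_E[OF Cons.IH this]
  have "(\<lambda>k. l k + of_nat (count (mset (map fst (x # w))) k) - of_nat (count (mset (map snd (x # w))) k))
    = (\<lambda>k. l k + of_nat (count (mset (map fst w)) k) - of_nat (count (mset (map snd w)) k)
        + of_bool (k = i) - of_bool (k = j))"
    by (auto simp: x fun_eq_iff)
  with step show ?case by (simp only: x word_Cons)
qed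

end

section \<open>Vanishing of the minors\<close>

text \<open>
  A simple module with a highest weight vector \<open>hv\<close> whose weight vanishes except at the first and at
  the last index.
\<close>

locale simple_gl_rep = gl_rep scale n E
  for scale :: "'k::field_char_0 \<Rightarrow> 'v::ab_group_add \<Rightarrow> 'v"
    and n :: nat and E :: "nat \<Rightarrow> nat \<Rightarrow> 'v \<Rightarrow> 'v" +
  fixes hv :: 'v and wt :: "nat \<Rightarrow> 'k"
  assumes simple: "invariant S \<Longrightarrow> S = {0} \<or> S = UNIV"
    and hv_nonzero: "hv \<noteq> 0"
    and hv_primitive: "primitive hv"
    and hv_weight: "is_weight_vector wt hv"
    and wt_middle: "0 < i \<Longrightarrow> i < n - 1 \<Longrightarrow> wt i = 0"
begin

text \<open>
  By simplicity the lowering words applied to \<open>x\<close> span the module, and every nonempty one has an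
  eigenvalue \<open>d + r\<close> with \<open>r > 0\<close>.
\<close>

lemma height_above_primitive:
  assumes x: "is_weight_vector l x" "primitive x" "x \<noteq> 0"
    and d: "height_op x = scale d x" and y: "height_op y = scale (d + of_int r) y"
  shows "r < 0 \<Longrightarrow> y = 0" and "r = 0 \<Longrightarrow> \<exists>a. y = scale a x"
proof -
  let ?L = "(\<lambda>w. word_op w x) ` lists lowering"
  have "x \<in> span ?L" by (intro span_base image_eqI[of _ _ "[]"]) auto
  with x(3) simple[OF invariant_span_lowering[OF x(1,2)]] have "y \<in> span ?L" by auto
  then have y_span: "y \<in> span {b \<in> ?L. height_op b = scale (d + of_int r) b}"
  proof (rule eigenvector_in_span[OF linear_height_op _ _ y])
    fix b assume "b \<in> ?L"
    then show "\<exists>\<alpha>. height_op b = scale \<alpha> b"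
      using height_op_word[OF lowering_letters d] by blast
  qed
  have "{b \<in> ?L. height_op b = scale (d + of_int r) b} \<subseteq> insert 0 (if r = 0 then {x} else {})"
    if "r \<le> 0"
  proof (rule subsetI, rule ccontr)
    fix b assume "b \<in> {b \<in> ?L. height_op b = scale (d + of_int r) b}"
      and n: "b \<notin> insert 0 (if r = 0 then {x} else {})"
    then obtain w where b: "b = word_op w x"
      and w: "w \<in> lists lowering" "height_op (word_op w x) = scale (d + of_int r) (word_op w x)" by blast
    have "scale (d + of_int (height w)) (word_op w x) = scale (d + of_int r) (word_op w x)"
      using w(2) unfolding height_op_word[OF lowering_letters[OF w(1)] d] .
    then have r: "height w = r" using n b by simp
    have "w = []"
    proof (rule ccontr)
      assume "w \<noteq> []"
      from height_lowering_pos[OF w(1) this] r that show False by simp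
    qed
    with r n b show False by (simp add: height_def)
  qed
  with y_span have *: "y \<in> span (insert 0 (if r = 0 then {x} else {}))" if "r \<le> 0"
    using that span_mono by blast
  show "y = 0" if "r < 0"
  proof -
    from * that have "y \<in> span {0}" by simp
    then show ?thesis by simp
  qed
  show "\<exists>a. y = scale a x" if "r = 0"
  proof -
    from * that have "y \<in> range (\<lambda>a. scale a x)" by (simp add: span_singleton)
    then show ?thesis by blast
  qed
qed

definition hv_height :: 'k where
  "hv_height = (\<Sum>i<n. of_nat i * wt i)"

lemma height_op_hv: "height_op hv = scale hv_height hv"
  using weight_height_op[OF hv_weight] by (simp add: hv_height_def)

text \<open>
  Otherwise \<open>x\<close> would generate the module by lowering, which only increases the height, and so could
  not reach the highest weight vector, whose height is smaller.
\<close>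

lemma primitive_lower_eq_0:
  assumes "is_weight_vector l x" "primitive x" "height_op x = scale (hv_height + of_int r) x" "r > 0"
  shows "x = 0"
proof (rule ccontr)
  assume "x \<noteq> 0"
  from height_above_primitive(1)[OF assms(1,2) this assms(3), of hv "- r"] assms(4)
  have "hv = 0" by (simp add: height_op_hv)
  with hv_nonzero show False ..
qed

text \<open>
  Only terms whose rightmost factor is diagonal survive, because otherwise it is a raising unit; in
  both of these, the middle factor acts by \<open>wt j = 0\<close> or is again a raising unit.
\<close>

lemma principal_minor_hv:
  assumes "i < j" "j < k" "k < n"
  shows "minor i j k i j k hv = 0"
proof -
  have factor: "shifted s p q hv = (if p = q then scale (wt p + s) hv else 0)" if "p \<le> q" "q < n" for s p q
    using that hv_weight hv_primitive
    by (auto simp: shifted_def is_weight_vector_def primitive_def scale_left_distrib)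
  have "wt j = 0" using wt_middle assms by auto
  then show ?thesis
    using assms by (simp add: minor_def minor_term_def factor shifted_scale shifted_zero)
qed

lemma same_minor_hv:
  assumes "i < n" "j < n" "k < n"
  shows "minor i j k i j k hv = 0"
proof (cases "i = j \<or> j = k \<or> i = k")
  case True
  then show ?thesis by (auto simp: minor_def)
next
  case False
  have s: "minor j i k j i k hv = minor i j k i j k hv" "minor i k j i k j hv = minor i j k i j k hv"
    if "i < n" "j < n" "k < n" for i j k
    using that by (simp_all add: minor_swap_rows(1)[of j i k] minor_swap_rows(2)[of i k j]
        minor_swap_cols[of i j k i j k])
  from False consider "i < j" "j < k" | "i < k" "k < j" | "j < i" "i < k" | "j < k" "k < i"
    | "k < i" "i < j" | "k < j" "j < i"
    using linorder_less_linear[of i j] linorder_less_linear[of j k] linorder_less_linear[of i k]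
    by blast
  then show ?thesis
  proof cases
    case 1 then show ?thesis using assms by (simp add: principal_minor_hv)
  next
    case 2 then show ?thesis using s(2)[of i j k] assms by (simp add: principal_minor_hv)
  next
    case 3 then show ?thesis using s(1)[of i j k] assms by (simp add: principal_minor_hv)
  next
    case 4 then show ?thesis using s(1)[of i j k] s(2)[of j i k] assms by (simp add: principal_minor_hv)
  next
    case 5 then show ?thesis using s(2)[of i j k] s(1)[of i k j] assms by (simp add: principal_minor_hv)
  next
    case 6 then show ?thesis
      using s(1)[of i j k] s(2)[of j i k] s(1)[of j k i] assms by (simp add: principal_minor_hv)
  qed
qed

text \<open>
  Induction on the height of the minor.  There are no vectors below the height of \<open>hv\<close>.  Raising units map the vector to minors of smaller height
  applied to \<open>hv\<close>, so if the height is positive then the vector is primitive and hence zero.  At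
  height zero it is a multiple of \<open>hv\<close>, so it vanishes unless the weight of the minor is zero, that is,
  unless rows and columns agree up to order; then antisymmetry reduces it to a principal minor.
\<close>

lemma minor_hv:
  assumes "i < n" "j < n" "k < n" "a < n" "b < n" "c < n"
  shows "minor i j k a b c hv = 0"
  using assms
proof (induction "nat (int i + int j + int k - int a - int b - int c)" arbitrary: i j k a b c rule: less_induct)
  case less
  let ?r = "int i + int j + int k - int a - int b - int c" and ?x = "minor i j k a b c hv"
  note wt = weight_minor[OF hv_weight less.prems]
  have ht: "height_op ?x = scale (hv_height + of_int ?r) ?x"
  proof -
    have coord: "(\<Sum>m<n. of_nat m * of_bool (m = r)) = (of_nat r :: 'k)" if "r < n" for r
      using that by (subst sum.cong[OF refl, of _ _ "\<lambda>m. if m = r then of_nat r else 0"]) auto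
    show ?thesis
      unfolding weight_height_op[OF wt] hv_height_def using less.prems
      by (simp only: distrib_left right_diff_distrib sum.distrib sum_subtractf coord) simp
  qed
  consider "?r < 0" | "?r > 0" | "?r = 0" by linarith
  then show ?case
  proof cases
    case 1
    then show ?thesis
      by (rule height_above_primitive(1)[OF hv_weight hv_primitive hv_nonzero height_op_hv ht])
  next
    case 2
    have "primitive ?x"
      unfolding primitive_def
    proof (intro allI impI)
      fix p q assume pq: "p < q" "q < n"
      then have "E p q hv = 0" using hv_primitive by (simp add: primitive_def)
      then have z: "minor i j k a b c (E p q hv) = 0"
        using less.prems by (simp add: minor_def minor_term_def shifted_zero)
      show "E p q ?x = 0"
      proof -
        have IH: "minor i' j' k' a' b' c' hv = 0"
          if "int i' + int j' + int k' - int a' - int b' - int c' < ?r"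
            "i' < n" "j' < n" "k' < n" "a' < n" "b' < n" "c' < n" for i' j' k' a' b' c'
          using that 2 by (intro less.hyps) auto
        have "(if q = i then minor p j k a b c hv else 0) = 0" "(if q = j then minor i p k a b c hv else 0) = 0"
          "(if q = k then minor i j p a b c hv else 0) = 0" "(if p = a then minor i j k q b c hv else 0) = 0"
          "(if p = b then minor i j k a q c hv else 0) = 0" "(if p = c then minor i j k a b q hv else 0) = 0"
          using pq less.prems by (auto intro!: IH)
        moreover have "p < n" using pq by simp
        ultimately show ?thesis
          using E_minor[OF _ pq(2) less.prems, of p hv] by (simp only: z) simp
      qed
    qed
    then show ?thesis
      using primitive_lower_eq_0[OF wt _ ht] 2 by blast
  next
    case 3
    then obtain s where s: "?x = scale s hv"
      using height_above_primitive(2)[OF hv_weight hv_primitive hv_nonzero height_op_hv ht] by blast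
    show ?thesis
    proof (cases "{#i, j, k#} = {#a, b, c#}")
      case True
      then consider "a = i" "b = j" "c = k" | "a = i" "b = k" "c = j" | "a = j" "b = i" "c = k"
        | "a = j" "b = k" "c = i" | "a = k" "b = i" "c = j" | "a = k" "b = j" "c = i"
        by (auto simp: add_eq_conv_ex add_mset_eq_single)
      then show ?thesis
        using same_minor_hv[of i j k] less.prems(1-3)
          minor_swap_cols[of i j k i j k hv] minor_swap_cols(2)[of i j k j i k hv]
          minor_swap_cols(1)[of i j k i k j hv] minor_swap_cols(1)[of i j k j k i hv]
        by cases simp_all
    next
      case False
      then obtain m where m: "count {#i, j, k#} m \<noteq> count {#a, b, c#} m"
        by (meson multiset_eqI)
      have "m < n"
        using m less.prems by (cases "m < n") (auto simp: not_less)
      have cnt: "of_nat (count {#r, s, t#} m) = of_bool (m = r) + of_bool (m = s) + (of_bool (m = t) :: 'k)"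
        for r s t by auto
      have "scale (wt m) ?x = E m m ?x"
        using hv_weight \<open>m < n\<close> unfolding s by (simp add: is_weight_vector_def E_scale mult.commute)
      also have "\<dots> = scale (wt m + of_nat (count {#i, j, k#} m) - of_nat (count {#a, b, c#} m)) ?x"
        using wt \<open>m < n\<close> unfolding cnt is_weight_vector_def by (simp add: algebra_simps)
      finally have "scale (of_nat (count {#i, j, k#} m) - of_nat (count {#a, b, c#} m)) ?x = 0"
        by (simp only: scale_left_distrib scale_left_diff_distrib) simp
      with m show ?thesis by (simp only: scale_eq_0_iff) simp
    qed
  qed
qed

text \<open>
  The vectors killed by all minors form a submodule, because commutators of minors with units are
  minors, and this submodule contains \<open>hv\<close>.
\<close>

lemma minor_eq_0:
  assumes "i < n" "j < n" "k < n" "a < n" "b < n" "c < n"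
  shows "minor i j k a b c v = 0"
proof -
  define N where "N = {v. \<forall>i<n. \<forall>j<n. \<forall>k<n. \<forall>a<n. \<forall>b<n. \<forall>c<n. minor i j k a b c v = 0}"
  have "invariant N"
    unfolding invariant_def
  proof (intro conjI allI impI ballI)
    show "subspace N"
      unfolding subspace_def N_def by (auto simp: minor_add minor_scale minor_zero)
  next
    fix p q v assume pq: "p < n" "q < n" and v: "v \<in> N"
    show "E p q v \<in> N"
      unfolding N_def
    proof (clarify)
      fix i j k a b c assume ind: "i < n" "j < n" "k < n" "a < n" "b < n" "c < n"
      have z: "minor i j k a b c v = 0" if "i < n" "j < n" "k < n" "a < n" "b < n" "c < n" for i j k a b c
        using v that by (simp add: N_def)
      have "(if P then minor i j k a b c v else 0) = 0"
        if "i < n" "j < n" "k < n" "a < n" "b < n" "c < n" for P i j k a b c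
        using z[OF that] by simp
      then show "minor i j k a b c (E p q v) = 0"
        using E_minor[OF pq ind, of v] z[OF ind] pq ind by (simp only: E_zero) simp
    qed
  qed
  moreover have "hv \<in> N" by (simp add: N_def minor_hv)
  ultimately have "N = UNIV" using simple hv_nonzero by blast
  then have "v \<in> N" by simp
  then show ?thesis using assms by (simp add: N_def)
qed

end

section \<open>Closed walks in balanced words\<close>

text \<open>The edges between consecutive vertices of an open walk and of a closed walk.\<close>

definition path :: "'a list \<Rightarrow> ('a \<times> 'a) list" where
  "path xs = zip xs (tl xs)"

definition cycle :: "'a list \<Rightarrow> ('a \<times> 'a) list" where
  "cycle xs = zip xs (rotate1 xs)"

lemma path_append:
  "xs \<noteq> [] \<Longrightarrow> ys \<noteq> [] \<Longrightarrow> path (xs @ ys) = path xs @ (last xs, hd ys) # path ys"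
proof (induction xs)
  case (Cons x xs)
  then show ?case by (cases xs; cases ys) (auto simp: path_def)
qed simp

lemma mset_cycle: "xs \<noteq> [] \<Longrightarrow> mset (cycle xs) = add_mset (last xs, hd xs) (mset (path xs))"
proof -
  assume "xs \<noteq> []"
  then obtain x xs' where "xs = x # xs'" by (cases xs) auto
  have "mset (zip (x # xs') (xs' @ [y])) = add_mset (last (x # xs'), y) (mset (zip (x # xs') xs'))" for x y
    by (induction xs' arbitrary: x) auto
  then show ?thesis using \<open>xs = x # xs'\<close> by (simp add: cycle_def path_def)
qed

lemma length_cycle [simp]: "length (cycle xs) = length xs"
  by (simp add: cycle_def)

lemma cycle_eq_Nil [simp]: "cycle xs = [] \<longleftrightarrow> xs = []"
  by (metis length_0_conv length_cycle)

context gl_rep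
begin

text \<open>These are the words that preserve every weight space.\<close>

definition balanced :: "(nat \<times> nat) list \<Rightarrow> bool" where
  "balanced w \<longleftrightarrow> w \<in> lists letters \<and> mset (map fst w) = mset (map snd w)"

lemma balanced_cycle: "set xs \<subseteq> {..<n} \<Longrightarrow> balanced (cycle xs)"
proof -
  assume "set xs \<subseteq> {..<n}"
  moreover have "set (cycle xs) \<subseteq> set xs \<times> set xs"
    unfolding cycle_def using set_zip_leftD set_zip_rightD by fastforce
  moreover have "mset (rotate1 xs) = mset xs" by (cases xs) auto
  ultimately show ?thesis
    by (auto simp: balanced_def cycle_def)
qed

lemma balanced_mset: "balanced w \<Longrightarrow> mset w = mset w' \<Longrightarrow> balanced w'"
  unfolding balanced_def by (metis in_lists_conv_set mset_eq_setD mset_map)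

lemma balanced_append: "balanced u \<Longrightarrow> balanced w \<Longrightarrow> balanced (u @ w)"
  by (auto simp: balanced_def)

lemma balanced_remove:
  assumes "balanced w" "balanced u" "mset w = mset (u @ v)"
  shows "balanced v"
proof -
  have "balanced (u @ v)" using assms balanced_mset by blast
  with assms(2) show ?thesis by (auto simp: balanced_def)
qed

text \<open>
  In a balanced word every vertex that has an incoming edge has an outgoing one.  Following a chosen
  outgoing edge \<open>(v, f v)\<close> from any start leads to a periodic orbit of \<open>f\<close>; with the least possible
  period its vertices are distinct, and so each of its edges is used only once.
\<close>

lemma balanced_contains_cycle:
  assumes "balanced w" "w \<noteq> []"
  obtains xs where "xs \<noteq> []" "set xs \<subseteq> {..<n}" "mset (cycle xs) \<subseteq># mset w"
proof -
  let ?V = "fst ` set w"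
  have V: "fst ` set w = snd ` set w"
    using assms(1) unfolding balanced_def by (metis mset_eq_setD set_map)
  have "\<forall>v\<in>?V. \<exists>v'. (v, v') \<in> set w" by force
  then obtain f where f: "\<And>v. v \<in> ?V \<Longrightarrow> (v, f v) \<in> set w"
    using bchoice[of ?V "\<lambda>v v'. (v, v') \<in> set w"] by blast
  have fV: "f v \<in> ?V" if "v \<in> ?V" for v
    unfolding V using f[OF that] by force
  obtain v0 where v0: "v0 \<in> ?V" using assms(2) by (cases w) auto
  define x where "x m = (f ^^ m) v0" for m
  have xV: "x m \<in> ?V" for m
    by (induction m) (auto simp: x_def v0 fV)
  have xS: "x (Suc m) = f (x m)" for m by (simp add: x_def)
  have "\<not> inj x"
    using xV range_inj_infinite finite_subset[of "range x" ?V] by blast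
  then obtain m m' where "m < m'" "x m = x m'"
    unfolding inj_def by (metis linorder_neqE_nat)
  then have period: "\<exists>p m. p > 0 \<and> x (m + p) = x m"
    by (intro exI[of _ "m' - m"] exI[of _ m]) auto
  define p where "p = (LEAST p. p > 0 \<and> (\<exists>m. x (m + p) = x m))"
  have "p > 0 \<and> (\<exists>m. x (m + p) = x m)"
    unfolding p_def by (rule LeastI_ex) (use period in blast)
  then obtain m where p: "p > 0" "x (m + p) = x m" by blast
  have min: "x (m + q) \<noteq> x m" if "q > 0" "q < p" for q m
  proof
    assume "x (m + q) = x m"
    with that(1) have "p \<le> q" unfolding p_def by (intro Least_le) blast
    with that(2) show False by simp
  qed
  define ys where "ys = map (\<lambda>r. x (m + r)) [0..<p]"
  have "x (m + r) \<noteq> x (m + r')" if "r < r'" "r' < p" for r r'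
    using min[of "r' - r" "m + r"] that less_imp_diff_less[of r' p r] by auto
  then have "distinct ys"
    unfolding ys_def distinct_map by (auto intro!: inj_onI) (metis linorder_neqE_nat)
  have "rotate1 ys = map f ys"
  proof -
    have "rotate1 (map (\<lambda>r. x (m + r)) [0..<p]) = map (\<lambda>r. x (m + Suc r)) [0..<p]"
    proof -
      obtain p' where p': "p = Suc p'" using p by (cases p) auto
      have "map (\<lambda>r. x (m + r)) [0..<p] = x m # map (\<lambda>r. x (m + Suc r)) [0..<p']"
        by (simp add: p' upt_conv_Cons flip: map_Suc_upt del: upt_Suc)
      then show ?thesis using p by (simp add: p')
    qed
    then show ?thesis by (simp add: ys_def xS)
  qed
  then have cyc: "cycle ys = map (\<lambda>y. (y, f y)) ys"
    by (simp add: cycle_def zip_map2 zip_same_conv_map)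
  have ysV: "set ys \<subseteq> ?V" using xV by (auto simp: ys_def)
  then have sub: "set (cycle ys) \<subseteq> set w" using f by (auto simp: cyc)
  have "distinct (cycle ys)"
    using \<open>distinct ys\<close> by (auto simp: cyc distinct_map intro: inj_onI)
  then have "mset (cycle ys) = mset_set (set (cycle ys))" by (simp add: mset_set_set)
  also have "\<dots> \<subseteq># mset_set (set w)" using sub by (intro subset_imp_msubset_mset_set) auto
  also have "\<dots> \<subseteq># mset w" using mset_set_set_mset_msubset[of "mset w"] by simp
  finally have "mset (cycle ys) \<subseteq># mset w" .
  moreover have "?V \<subseteq> {..<n}" using assms(1) by (auto simp: balanced_def)
  ultimately show ?thesis
    using that[of ys] ysV p by (auto simp: ys_def)
qed

end

section \<open>Subspaces that are stable under the Casimir elements\<close>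

text \<open>
  Stability under the Casimir algebra, expressed by its generators: up to scalars these are the
  diagonal units and the symmetrised products \<open>E i j * E j i + E j i * E i j\<close>.
\<close>

locale casimir_stable = simple_gl_rep +
  fixes S
  assumes subspace_S: "subspace S"
    and E_diag_S: "i < n \<Longrightarrow> s \<in> S \<Longrightarrow> E i i s \<in> S"
    and casimir_S: "i < n \<Longrightarrow> j < n \<Longrightarrow> i \<noteq> j \<Longrightarrow> s \<in> S \<Longrightarrow> E i j (E j i s) + E j i (E i j s) \<in> S"
begin

lemmas S_closed = subspace_add[OF subspace_S] subspace_diff[OF subspace_S]
  subspace_0[OF subspace_S] subspace_scale[OF subspace_S]

lemma S_add_cancel:
  assumes "x - y \<in> S" shows "x \<in> S \<longleftrightarrow> y \<in> S"
  using subspace_add[OF subspace_S assms] subspace_diff[OF subspace_S _ assms]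
  by (metis diff_add_cancel diff_diff_eq2 add_diff_cancel_left')

lemma S_half: "x + x \<in> S \<Longrightarrow> x \<in> S"
proof -
  assume "x + x \<in> S"
  then have "scale (1 / 2) (x + x) \<in> S" by (rule subspace_scale[OF subspace_S])
  moreover have "scale (1 / 2) (x + x) = scale (1 / 2 + 1 / 2) x"
    by (simp only: scale_left_distrib scale_right_distrib)
  ultimately show ?thesis by simp
qed

definition stabilizes :: "(nat \<times> nat) list \<Rightarrow> bool" where
  "stabilizes w \<longleftrightarrow> (\<forall>s\<in>S. word_op w s \<in> S)"

lemma stabilizes_append: "stabilizes u \<Longrightarrow> stabilizes w \<Longrightarrow> stabilizes (u @ w)"
  by (simp add: stabilizes_def word_append)

text \<open>
  The induction hypothesis of \<open>stabilizes_balanced\<close>.  Under it, two words of length at most \<open>k\<close> may be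
  identified if they differ by shorter balanced words.
\<close>

definition stabilizes_below :: "nat \<Rightarrow> bool" where
  "stabilizes_below k \<longleftrightarrow> (\<forall>w. balanced w \<and> length w < k \<longrightarrow> stabilizes w)"

lemma stabilizes_belowD: "stabilizes_below k \<Longrightarrow> balanced w \<Longrightarrow> length w < k \<Longrightarrow> s \<in> S \<Longrightarrow> word_op w s \<in> S"
  by (simp add: stabilizes_below_def stabilizes_def)

text \<open>
  The commutator of two letters is a difference of at most two letters, each of which replaces the
  pair by a single edge with the same balance.
\<close>

lemma swap_letters:
  assumes k: "stabilizes_below k" "length (u @ x # y # w) \<le> k"
    and bal: "balanced (u @ x # y # w)" and s: "s \<in> S"
  shows "word_op (u @ x # y # w) s - word_op (u @ y # x # w) s \<in> S"
proof -
  obtain i j a b where xy: "x = (i, j)" "y = (a, b)" by fastforce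
  let ?t = "word_op w s"
  have lt: "i < n" "j < n" "a < n" "b < n" and u: "u \<in> lists letters"
    using bal by (auto simp: balanced_def xy)
  have "word_op (u @ x # y # w) s - word_op (u @ y # x # w) s =
    word_op u ((if j = a then E i b ?t else 0) - (if b = i then E a j ?t else 0))"
    using lt u E_comm[of i j a b ?t] by (simp add: xy word_append flip: word_diff)
  also have "\<dots> = (if j = a then word_op (u @ (i, b) # w) s else 0) - (if b = i then word_op (u @ (a, j) # w) s else 0)"
    using u by (simp add: word_diff word_append word_zero)
  also have "\<dots> \<in> S"
  proof -
    have "word_op (u @ (i, b) # w) s \<in> S" if "j = a"
      using bal k that by (intro stabilizes_belowD[OF _ _ _ s]) (auto simp: balanced_def xy)
    moreover have "word_op (u @ (a, j) # w) s \<in> S" if "b = i"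
      using bal k that by (intro stabilizes_belowD[OF _ _ _ s]) (auto simp: balanced_def xy add_mset_commute)
    ultimately show ?thesis by (simp add: S_closed)
  qed
  finally show ?thesis .
qed

lemma S_diff_trans: "x - y \<in> S \<Longrightarrow> y - z \<in> S \<Longrightarrow> x - z \<in> S"
  using subspace_add[OF subspace_S, of "x - y" "y - z"] by simp

lemma move_letter:
  assumes k: "stabilizes_below k" and s: "s \<in> S"
  shows "length (u @ x # v @ w) \<le> k \<Longrightarrow> balanced (u @ x # v @ w) \<Longrightarrow>
    word_op (u @ x # v @ w) s - word_op (u @ v @ x # w) s \<in> S"
proof (induction v arbitrary: u)
  case Nil
  then show ?case by (simp add: S_closed)
next
  case (Cons y v)
  have "word_op (u @ x # y # v @ w) s - word_op (u @ y # x # v @ w) s \<in> S"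
    using Cons.prems by (intro swap_letters[OF k _ _ s]) auto
  moreover have "word_op ((u @ [y]) @ x # v @ w) s - word_op ((u @ [y]) @ v @ x # w) s \<in> S"
    using Cons.prems balanced_mset[OF Cons.prems(2), of "u @ y # x # v @ w"] by (intro Cons.IH) auto
  ultimately show ?case using S_diff_trans by simp
qed

lemma permute_letters:
  assumes k: "stabilizes_below k" and s: "s \<in> S"
  shows "length (u @ w) \<le> k \<Longrightarrow> balanced (u @ w) \<Longrightarrow> mset w = mset w' \<Longrightarrow>
    word_op (u @ w) s - word_op (u @ w') s \<in> S"
proof (induction w arbitrary: u w')
  case Nil
  then show ?case by (simp add: S_closed)
next
  case (Cons x w)
  from Cons.prems(3) have "x \<in> set w'" by (metis list.set_intros(1) mset_eq_setD)
  then obtain a b where w': "w' = a @ x # b" by (meson split_list)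
  have "word_op ((u @ [x]) @ w) s - word_op ((u @ [x]) @ (a @ b)) s \<in> S"
    using Cons.prems by (intro Cons.IH) (auto simp: w')
  moreover have "word_op (u @ x # a @ b) s - word_op (u @ a @ x # b) s \<in> S"
  proof (rule move_letter[OF k s])
    show "balanced (u @ x # a @ b)"
      using Cons.prems by (intro balanced_mset[OF Cons.prems(2)]) (auto simp: w')
    have "length w = length (a @ b)"
      using Cons.prems(3) by (intro mset_eq_length) (auto simp: w')
    then show "length (u @ x # a @ b) \<le> k" using Cons.prems(1) by simp
  qed
  ultimately show ?case using S_diff_trans by (simp add: w')
qed

lemma word_cong_mset:
  assumes "stabilizes_below k" "length w \<le> k" "balanced w" "mset w = mset w'" "s \<in> S"
  shows "word_op w s - word_op w' s \<in> S"
  using permute_letters[of k s "[]" w w'] assms by simp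

lemma stabilizes_cong_mset:
  assumes "stabilizes_below k" "length w \<le> k" "balanced w" "mset w = mset w'" "stabilizes w'"
  shows "stabilizes w"
  unfolding stabilizes_def
proof
  fix s assume "s \<in> S"
  with S_add_cancel[OF word_cong_mset[OF assms(1-4)]] assms(5) show "word_op w s \<in> S"
    by (simp add: stabilizes_def)
qed

lemma stabilizes_split:
  assumes k: "stabilizes_below k" "length w \<le> k" and w: "mset w = mset (u @ v)"
    and uv: "balanced u" "balanced v" "u \<noteq> []" "v \<noteq> []"
  shows "stabilizes w"
proof -
  have "length w = length u + length v" using mset_eq_length[OF w] by simp
  moreover have "length u > 0" "length v > 0" using uv by auto
  ultimately have "length u < k" "length v < k" using k(2) by linarith+
  then have "stabilizes u" "stabilizes v"
    using k(1) uv unfolding stabilizes_below_def by blast+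
  then have "stabilizes (u @ v)" by (rule stabilizes_append)
  moreover have "balanced w" using balanced_append[OF uv(1,2)] w balanced_mset by metis
  ultimately show ?thesis using stabilizes_cong_mset k w by blast
qed

text \<open>
  The terms in which a shift is chosen arise by deleting a loop \<open>(i, i)\<close> from the word, so they
  are shorter and still balanced.
\<close>

lemma word_minor_term:
  assumes k: "stabilizes_below k" "length w + 3 \<le> k" and s: "s \<in> S"
    and bal: "balanced ((i, a) # (j, b) # (l, c) # w)"
  shows "word_op ((i, a) # (j, b) # (l, c) # w) s - minor_term i j l a b c (word_op w s) \<in> S"
proof -
  let ?t = "word_op w s"
  have lt: "i < n" "j < n" "l < n" "a < n" "b < n" "c < n" using bal by (auto simp: balanced_def)
  have "word_op ((i, a) # (j, b) # (l, c) # w) s - minor_term i j l a b c ?t =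
     (if l = c then E i a (E j b ?t) else 0) - (if i = a then E j b (E l c ?t) else 0)
     + (if i = a then if l = c then E j b ?t else 0 else 0)"
    using lt by (simp add: minor_term_def shifted_def E_linear_simps)
  also have "\<dots> \<in> S"
  proof -
    have "E i a (E j b ?t) \<in> S" if "l = c"
      using stabilizes_belowD[OF k(1) _ _ s, of "(i, a) # (j, b) # w"] k(2) bal that
      by (auto simp: balanced_def add_mset_commute)
    moreover have "E j b (E l c ?t) \<in> S" if "i = a"
      using stabilizes_belowD[OF k(1) _ _ s, of "(j, b) # (l, c) # w"] k(2) bal that
      by (auto simp: balanced_def)
    moreover have "E j b ?t \<in> S" if "i = a" "l = c"
      using stabilizes_belowD[OF k(1) _ _ s, of "(j, b) # w"] k(2) bal that
      by (auto simp: balanced_def add_mset_commute)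
    ultimately show ?thesis by (auto simp: S_closed)
  qed
  finally show ?thesis .
qed

text \<open>
  The left-hand side is, up to shorter words, a minor applied to the vector \<open>word_op w s\<close>, hence zero.
\<close>

lemma minor_words:
  assumes k: "stabilizes_below k" "length w + 3 \<le> k" and s: "s \<in> S"
    and bal: "balanced ((i, a) # (j, b) # (l, c) # w)"
  shows "word_op ((i, a) # (j, b) # (l, c) # w) s + word_op ((j, a) # (l, b) # (i, c) # w) s
    + word_op ((l, a) # (i, b) # (j, c) # w) s - word_op ((j, a) # (i, b) # (l, c) # w) s
    - word_op ((i, a) # (l, b) # (j, c) # w) s - word_op ((l, a) # (j, b) # (i, c) # w) s \<in> S" (is "?X \<in> S")
proof -
  have lt: "i < n" "j < n" "l < n" "a < n" "b < n" "c < n" using bal by (auto simp: balanced_def)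
  define D where "D i j l = word_op ((i, a) # (j, b) # (l, c) # w) s - minor_term i j l a b c (word_op w s)" for i j l
  have D: "D i' j' l' \<in> S" if "{#i', j', l'#} = {#i, j, l#}" for i' j' l'
    unfolding D_def
  proof (rule word_minor_term[OF k s])
    have "mset (map fst ((i', a) # (j', b) # (l', c) # w)) = {#i', j', l'#} + mset (map fst w)"
      by simp
    also have "\<dots> = mset (map fst ((i, a) # (j, b) # (l, c) # w))"
      unfolding that by simp
    also have "\<dots> = mset (map snd ((i', a) # (j', b) # (l', c) # w))"
      using bal by (simp add: balanced_def)
    finally have "mset (map fst ((i', a) # (j', b) # (l', c) # w)) = mset (map snd ((i', a) # (j', b) # (l', c) # w))" .
    moreover have "set_mset {#i', j', l'#} \<subseteq> {..<n}" unfolding that using lt by simp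
    then have "(i', a) # (j', b) # (l', c) # w \<in> lists letters"
      using bal by (simp add: balanced_def)
    ultimately show "balanced ((i', a) # (j', b) # (l', c) # w)"
      unfolding balanced_def by blast
  qed
  have "?X = D i j l + D j l i + D l i j - D j i l - D i l j - D l j i + minor i j l a b c (word_op w s)"
    by (simp add: D_def minor_def)
  also have "\<dots> \<in> S"
    using lt by (simp add: minor_eq_0 S_closed D add_mset_commute)
  finally show ?thesis .
qed

text \<open>
  The rows of the minor are the last vertices of the blocks, its columns are the first vertices, and
  the open walks inside the blocks form the remaining factor.  Each of the six terms connects the
  blocks by a permutation: the two 3-cycles give the two closed walks of the statement, with equal
  signs, and the other four terms fall apart into at least two closed walks.
\<close>

lemma block_swap:
  assumes k: "stabilizes_below k" "length (A @ B @ C) \<le> k" and s: "s \<in> S"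
    and ne: "A \<noteq> []" "B \<noteq> []" "C \<noteq> []" and sub: "set (A @ B @ C) \<subseteq> {..<n}"
  shows "word_op (cycle (A @ B @ C)) s + word_op (cycle (B @ A @ C)) s \<in> S"
proof -
  let ?w = "path A @ path B @ path C"
  let ?W = "\<lambda>x y z. (x, hd B) # (y, hd C) # (z, hd A) # ?w"
  have len: "length ?w + 3 \<le> k"
    using k(2) ne by (cases A; cases B; cases C) (auto simp: path_def)
  have lenW: "length (?W x y z) \<le> k" for x y z using len by simp
  note ms = path_append mset_cycle ne
  have m1: "mset (cycle (A @ B @ C)) = mset (?W (last A) (last B) (last C))"
    and m2: "mset (?W (last B) (last C) (last A)) = mset (cycle B @ (cycle C @ cycle A))"
    and m3: "mset (cycle (B @ A @ C)) = mset (?W (last C) (last A) (last B))"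
    and m4: "mset (?W (last B) (last A) (last C)) = mset (cycle B @ cycle (A @ C))"
    and m5: "mset (?W (last A) (last C) (last B)) = mset (cycle C @ cycle (A @ B))"
    and m6: "mset (?W (last C) (last B) (last A)) = mset (cycle A @ cycle (B @ C))"
    using ne by (simp_all add: ms)
  have bal: "balanced (cycle xs)" if "set xs \<subseteq> set (A @ B @ C)" for xs
    using that sub by (intro balanced_cycle) auto
  have g2: "stabilizes (?W (last B) (last C) (last A))"
    using ne by (intro stabilizes_split[OF k(1) lenW m2] balanced_append bal) auto
  have g4: "stabilizes (?W (last B) (last A) (last C))"
    using ne by (intro stabilizes_split[OF k(1) lenW m4] balanced_append bal) auto
  have g5: "stabilizes (?W (last A) (last C) (last B))"
    using ne by (intro stabilizes_split[OF k(1) lenW m5] balanced_append bal) auto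
  have g6: "stabilizes (?W (last C) (last B) (last A))"
    using ne by (intro stabilizes_split[OF k(1) lenW m6] balanced_append bal) auto
  have c1: "word_op (cycle (A @ B @ C)) s - word_op (?W (last A) (last B) (last C)) s \<in> S"
    using k(2) by (intro word_cong_mset[OF k(1) _ bal m1 s]) auto
  have c3: "word_op (cycle (B @ A @ C)) s - word_op (?W (last C) (last A) (last B)) s \<in> S"
    using k(2) by (intro word_cong_mset[OF k(1) _ bal m3 s]) auto
  have "balanced (?W (last A) (last B) (last C))"
    using m1 balanced_mset[OF bal[of "A @ B @ C"]] by simp
  note rel = minor_words[OF k(1) len s this]
  have "t1 + t3 \<in> S"
    if "t1 + t2 + t3 - t4 - t5 - t6 \<in> S" "t2 \<in> S" "t4 \<in> S" "t5 \<in> S" "t6 \<in> S" for t1 t2 t3 t4 t5 t6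
  proof -
    have "(t1 + t2 + t3 - t4 - t5 - t6) - t2 + t4 + t5 + t6 \<in> S"
      by (intro S_closed that)
    then show ?thesis by (simp add: algebra_simps)
  qed
  from this[OF rel] g2 g4 g5 g6 s
  have "word_op (?W (last A) (last B) (last C)) s + word_op (?W (last C) (last A) (last B)) s \<in> S"
    unfolding stabilizes_def by blast
  from subspace_add[OF subspace_S subspace_add[OF subspace_S c1 c3] this]
  show ?thesis by (simp add: algebra_simps)
qed

lemma mset_cycle_rotate:
  assumes "A \<noteq> []" "B \<noteq> []"
  shows "mset (cycle (A @ B)) = mset (cycle (B @ A))"
  using assms by (simp add: mset_cycle path_append)

text \<open>
  Write \<open>x y z C\<close> for the walk.  Moving \<open>z\<close> to the front at once, past the block \<open>x y\<close>, costs one sign;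
  moving it past \<open>y\<close> and then past \<open>x\<close> costs two.  This needs a third nonempty block in each exchange,
  hence at least four vertices.
\<close>

lemma stabilizes_long_cycle:
  assumes k: "stabilizes_below (length xs)" and len: "length xs \<ge> 4" and sub: "set xs \<subseteq> {..<n}"
  shows "stabilizes (cycle xs)"
  unfolding stabilizes_def
proof
  fix s assume s: "s \<in> S"
  obtain x y z C where xs: "xs = x # y # z # C" and C: "C \<noteq> []"
    using len by (cases xs; cases "tl xs"; cases "tl (tl xs)"; cases "tl (tl (tl xs))") auto
  let ?f = "\<lambda>xs. word_op (cycle xs) s"
  have 1: "?f (x # y # z # C) + ?f (z # x # y # C) \<in> S"
    using block_swap[OF k _ s, of "[x, y]" "[z]" C] sub C by (simp add: xs)
  have 2: "?f (x # z # y # C) + ?f (z # x # y # C) \<in> S"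
    using block_swap[OF k _ s, of "[x]" "[z]" "y # C"] sub by (simp add: xs)
  \<comment> \<open>The exchange of \<open>y\<close> and \<open>z\<close> is made in the walk rotated to begin with \<open>y\<close>.\<close>
  have 3: "?f (y # z # C @ [x]) + ?f (z # y # C @ [x]) \<in> S"
    using block_swap[OF k _ s, of "[y]" "[z]" "C @ [x]"] sub by (simp add: xs)
  have rot: "?f (x # D) - ?f (D @ [x]) \<in> S" if "set D \<subseteq> {..<n}" "D \<noteq> []" "length D + 1 = length xs" for D
    using word_cong_mset[OF k _ balanced_cycle mset_cycle_rotate[of "[x]" D] s] that sub by (simp add: xs)
  have 4: "?f (x # y # z # C) - ?f (y # z # C @ [x]) \<in> S"
    using rot[of "y # z # C"] sub by (simp add: xs)
  have 5: "?f (x # z # y # C) - ?f (z # y # C @ [x]) \<in> S"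
    using rot[of "z # y # C"] sub by (simp add: xs)
  have "(?f (x # y # z # C) + ?f (z # x # y # C)) - (?f (x # z # y # C) + ?f (z # x # y # C))
      + (?f (y # z # C @ [x]) + ?f (z # y # C @ [x]))
      + (?f (x # y # z # C) - ?f (y # z # C @ [x])) + (?f (x # z # y # C) - ?f (z # y # C @ [x])) \<in> S"
    by (intro S_closed 1 2 3 4 5)
  then have "?f xs + ?f xs \<in> S" by (simp add: xs algebra_simps)
  then show "?f xs \<in> S" by (rule S_half)
qed

lemma stabilizes_cycle_1: "i < n \<Longrightarrow> stabilizes (cycle [i])"
  by (simp add: stabilizes_def cycle_def E_diag_S)

text \<open>
  \<open>E i j * E j i\<close> differs from half of the Casimir element only by half of \<open>E i i - E j j\<close>.
\<close>

lemma stabilizes_cycle_2: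
  assumes "i < n" "j < n"
  shows "stabilizes (cycle [i, j])"
  unfolding stabilizes_def
proof
  fix s assume s: "s \<in> S"
  show "word_op (cycle [i, j]) s \<in> S"
  proof (cases "i = j")
    case True
    with s assms show ?thesis by (simp add: cycle_def E_diag_S)
  next
    case False
    have "(E i j (E j i s) + E j i (E i j s)) + (E i i s - E j j s) \<in> S"
      using s assms False by (intro S_closed casimir_S E_diag_S)
    also have "(E i j (E j i s) + E j i (E i j s)) + (E i i s - E j j s) =
        E i j (E j i s) + E i j (E j i s)"
      using assms E_comm[of i j j i s] by (simp add: algebra_simps)
    finally have "E i j (E j i s) \<in> S" by (rule S_half)
    then show ?thesis by (simp add: cycle_def)
  qed
qed

text \<open>
  If a vertex is repeated, the walk decomposes.  Otherwise the commutator of \<open>E i j * E j i\<close> and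
  \<open>E j l * E l j\<close> is the difference of the two orientations of the triangle, and \<open>block_swap\<close> gives
  their sum.
\<close>

lemma stabilizes_cycle_3:
  assumes k: "stabilizes_below 3" and lt: "i < n" "j < n" "l < n"
  shows "stabilizes (cycle [i, j, l])"
proof (cases "i = j \<or> j = l \<or> i = l")
  case True
  then consider "i = j" | "j = l" | "i = l" by blast
  then show ?thesis
  proof cases
    case 1
    with lt show ?thesis
      by (intro stabilizes_split[OF k, of _ "cycle [i]" "cycle [i, l]"] balanced_cycle) (auto simp: cycle_def)
  next
    case 2
    with lt show ?thesis
      by (intro stabilizes_split[OF k, of _ "cycle [j]" "cycle [i, j]"] balanced_cycle) (auto simp: cycle_def)
  next
    case 3
    with lt show ?thesis
      by (intro stabilizes_split[OF k, of _ "cycle [i]" "cycle [i, j]"] balanced_cycle) (auto simp: cycle_def)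
  qed
next
  case False
  show ?thesis
    unfolding stabilizes_def
  proof
    fix s assume s: "s \<in> S"
    have c2: "E a b (E b a t) \<in> S" if "a < n" "b < n" "t \<in> S" for a b t
      using stabilizes_cycle_2[OF that(1,2)] that(3) by (simp add: stabilizes_def cycle_def)
    have "E i j (E j i (E j l (E l j s))) - E j l (E l j (E i j (E j i s))) \<in> S"
      using s lt by (intro S_closed c2)
    also have "E i j (E j i (E j l (E l j s))) - E j l (E l j (E i j (E j i s))) =
       E i l (E l j (E j i s)) - E i j (E j l (E l i s))"
      using lt False by (simp add: E_comm[of i j j l] E_comm[of i j l j] E_comm[of j i j l]
          E_comm[of j i l j] E_linear_simps)
    finally have 1: "word_op [(i, l), (l, j), (j, i)] s - word_op (cycle [i, j, l]) s \<in> S"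
      by (simp add: cycle_def)
    have 2: "word_op (cycle [j, i, l]) s - word_op [(i, l), (l, j), (j, i)] s \<in> S"
      using lt by (intro word_cong_mset[OF k _ balanced_cycle _ s]) (auto simp: cycle_def)
    have 3: "word_op (cycle [i, j, l]) s + word_op (cycle [j, i, l]) s \<in> S"
      using block_swap[OF k _ s, of "[i]" "[j]" "[l]"] lt by simp
    from subspace_diff[OF subspace_S 3 subspace_add[OF subspace_S 1 2]]
    have "word_op (cycle [i, j, l]) s + word_op (cycle [i, j, l]) s \<in> S"
      by (simp add: algebra_simps)
    then show "word_op (cycle [i, j, l]) s \<in> S" by (rule S_half)
  qed
qed

lemma stabilizes_cycle:
  assumes k: "stabilizes_below (length xs)" and "xs \<noteq> []" and sub: "set xs \<subseteq> {..<n}"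
  shows "stabilizes (cycle xs)"
proof -
  from \<open>xs \<noteq> []\<close> have "length xs \<noteq> 0" by simp
  then consider "length xs = 1" | "length xs = 2" | "length xs = 3" | "length xs \<ge> 4" by linarith
  then show ?thesis
  proof cases
    case 1
    with sub show ?thesis by (auto simp: length_Suc_conv intro: stabilizes_cycle_1)
  next
    case 2
    with sub show ?thesis by (auto simp: numeral_2_eq_2 length_Suc_conv intro: stabilizes_cycle_2)
  next
    case 3
    with sub k show ?thesis by (auto simp: numeral_3_eq_3 length_Suc_conv intro: stabilizes_cycle_3)
  next
    case 4
    with k sub show ?thesis by (intro stabilizes_long_cycle)
  qed
qed

text \<open>
  Splitting off one cycle either leaves a shorter balanced word beside a shorter cycle, or shows
  that the word is a cycle up to order.
\<close>

lemma stabilizes_balanced: "balanced w \<Longrightarrow> stabilizes w"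
proof (induction "length w" arbitrary: w rule: less_induct)
  case less
  then have k: "stabilizes_below (length w)" by (simp add: stabilizes_below_def)
  show ?case
  proof (cases "w = []")
    case True
    then show ?thesis by (simp add: stabilizes_def)
  next
    case False
    obtain xs where xs: "xs \<noteq> []" "set xs \<subseteq> {..<n}" "mset (cycle xs) \<subseteq># mset w"
      using balanced_contains_cycle[OF less.prems False] by blast
    obtain u where u: "mset u = mset w - mset (cycle xs)" using ex_mset by blast
    with xs(3) have w: "mset w = mset (cycle xs @ u)" by simp
    have bal: "balanced (cycle xs)" "balanced u"
      using balanced_remove[OF less.prems _ w] balanced_cycle[OF xs(2)] by auto
    show ?thesis
    proof (cases "u = []")
      case True
      then have "length xs = length w" using mset_eq_length[OF w] by simp
      then have "stabilizes (cycle xs)" using stabilizes_cycle xs(1,2) k by metis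
      with True w show ?thesis using stabilizes_cong_mset[OF k _ less.prems] by simp
    next
      case False
      with bal xs show ?thesis
        by (intro stabilizes_split[OF k _ w]) auto
    qed
  qed
qed

text \<open>
  The words applied to \<open>s\<close> span the module.  Taking components along the eigenvectors of
  \<open>E 0 0\<close>, \<open>E 1 1\<close> and so on in turn leaves only words of weight zero, which are balanced.
\<close>

lemma weight_vector_in_S:
  assumes s: "s \<in> S" "s \<noteq> 0" "is_weight_vector l s" and v: "is_weight_vector l v"
  shows "v \<in> S"
proof -
  let ?B = "(\<lambda>w. word_op w s) ` lists letters"
  have "v \<in> span {b \<in> ?B. \<forall>i<m. E i i b = scale (l i) b}" if "m \<le> n" for m
    using that
  proof (induction m)
    case 0
    have "s \<in> span ?B" by (intro span_base image_eqI[of _ _ "[]"]) auto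
    with s simple[OF invariant_span_words[of s]] show ?case by auto
  next
    case (Suc m)
    let ?C = "{b \<in> ?B. \<forall>i<m. E i i b = scale (l i) b}"
    have "v \<in> span {b \<in> ?C. E m m b = scale (l m) b}"
    proof (rule eigenvector_in_span)
      show "Vector_Spaces.linear scale scale (E m m)" using Suc.prems by (intro linear_E) auto
      show "v \<in> span ?C" using Suc by simp
      show "E m m v = scale (l m) v" using v Suc.prems by (simp add: is_weight_vector_def)
      show "\<exists>\<alpha>. E m m b = scale \<alpha> b" if "b \<in> ?C" for b
        using that weight_word[OF s(3)] Suc.prems unfolding is_weight_vector_def by fastforce
    qed
    moreover have "{b \<in> ?C. E m m b = scale (l m) b} = {b \<in> ?B. \<forall>i<Suc m. E i i b = scale (l i) b}"
      by (auto simp: less_Suc_eq)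
    ultimately show ?case by simp
  qed
  then have "v \<in> span {b \<in> ?B. \<forall>i<n. E i i b = scale (l i) b}" by simp
  also have "\<dots> \<subseteq> S"
  proof (rule span_minimal[OF _ subspace_S], rule subsetI)
    fix b assume "b \<in> {b \<in> ?B. \<forall>i<n. E i i b = scale (l i) b}"
    then obtain w where b: "b = word_op w s" and w: "w \<in> lists letters"
      and wt: "\<forall>i<n. E i i (word_op w s) = scale (l i) (word_op w s)" by blast
    have "word_op w s \<in> S"
    proof (cases "word_op w s = 0")
      case False
      have "count (mset (map fst w)) i = count (mset (map snd w)) i" for i
      proof (cases "i < n")
        case True
        with wt weight_word[OF s(3) w]
        have "scale (l i + of_nat (count (mset (map fst w)) i) - of_nat (count (mset (map snd w)) i)) (word_op w s)
          = scale (l i) (word_op w s)"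
          unfolding is_weight_vector_def by metis
        with False show ?thesis by simp
      next
        case False
        with w have "i \<notin> set (map fst w)" "i \<notin> set (map snd w)" by auto
        then show ?thesis by (metis count_mset_0_iff)
      qed
      then have "balanced w" using w by (auto simp: balanced_def intro: multiset_eqI)
      with stabilizes_balanced s(1) show ?thesis by (auto simp: stabilizes_def)
    qed (simp add: S_closed)
    then show "b \<in> S" by (simp add: b)
  qed
  finally show ?thesis .
qed

end

section \<open>Roots and coroots of traceless matrices\<close>

text \<open>
  The traceless part of a matrix unit.  The brackets of these matrices follow the formula for matrix
  units, since scalar matrices are central and a commutator is traceless.
\<close>

definition unit_sl :: "nat \<Rightarrow> nat \<Rightarrow> nat \<Rightarrow> complex mat" where
  "unit_sl n i j = mat n n (\<lambda>(a, b). of_bool (a = i \<and> b = j) - of_bool (i = j \<and> a = b) / of_nat n)"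

lemma unit_sl_index:
  "a < n \<Longrightarrow> b < n \<Longrightarrow> unit_sl n i j $$ (a, b) = of_bool (a = i \<and> b = j) - of_bool (i = j \<and> a = b) / of_nat n"
  by (simp add: unit_sl_def)

lemma unit_sl_carrier [simp]: "unit_sl n i j \<in> carrier_mat n n"
  by (simp add: unit_sl_def)

lemma unit_sl_off_diag: "i \<noteq> j \<Longrightarrow> unit_sl n i j = mat_unit n i j"
  by (auto simp: unit_sl_def mat_unit_def intro!: eq_matI)

lemma unit_sl_in_sl:
  assumes "i < n"
  shows "unit_sl n i j \<in> sl n"
proof -
  have "(\<Sum>a<n. unit_sl n i j $$ (a, a)) = (\<Sum>a<n. (if a = i then of_bool (i = j) else 0) - of_bool (i = j) / of_nat n)"
    by (intro sum.cong) (auto simp: unit_sl_index)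
  also have "\<dots> = 0"
    using assms by (simp add: sum_subtractf)
  finally show ?thesis by (simp add: sl_def)
qed

lemma unit_sl_in_cartan: "i < n \<Longrightarrow> unit_sl n i i \<in> cartan n"
  using unit_sl_in_sl[of i n i] by (auto simp: cartan_def diagonal_mat_def unit_sl_index unit_sl_def)

lemma sl_carrier: "X \<in> sl n \<Longrightarrow> X \<in> carrier_mat n n"
  by (simp add: sl_def)

lemma cartan_sl: "H \<in> cartan n \<Longrightarrow> H \<in> sl n"
  by (simp add: cartan_def)

lemma mult_index:
  assumes "X \<in> carrier_mat n n" "Y \<in> carrier_mat n n" "a < n" "b < n"
  shows "(X * Y) $$ (a, b) = (\<Sum>c<n. X $$ (a, c) * Y $$ (c, b))"
  using assms by (auto simp: scalar_prod_def lessThan_atLeast0)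

lemma bracket_index:
  assumes "X \<in> carrier_mat n n" "Y \<in> carrier_mat n n" "a < n" "b < n"
  shows "lie_bracket X Y $$ (a, b) = (X * Y) $$ (a, b) - (Y * X) $$ (a, b)"
  using assms unfolding lie_bracket_def by (subst index_minus_mat) auto

lemma bracket_unit_sl_index:
  assumes "Y \<in> carrier_mat n n" "a < n" "b < n" "i < n" "j < n"
  shows "lie_bracket (unit_sl n i j) Y $$ (a, b) =
    of_bool (a = i) * Y $$ (j, b) - of_bool (b = j) * Y $$ (a, i)"
proof -
  have "(unit_sl n i j * Y) $$ (a, b) = (\<Sum>c<n. (if c = j then of_bool (a = i) * Y $$ (j, b) else 0)
      - (if c = a then of_bool (i = j) / of_nat n * Y $$ (a, b) else 0))"
    unfolding mult_index[OF unit_sl_carrier assms(1-3)]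
    using assms by (intro sum.cong) (auto simp: unit_sl_index algebra_simps)
  also have "\<dots> = of_bool (a = i) * Y $$ (j, b) - of_bool (i = j) / of_nat n * Y $$ (a, b)"
    using assms by (simp add: sum_subtractf)
  finally have 1: "(unit_sl n i j * Y) $$ (a, b) = \<dots>" .
  have "(Y * unit_sl n i j) $$ (a, b) = (\<Sum>c<n. (if c = i then of_bool (b = j) * Y $$ (a, i) else 0)
      - (if c = b then of_bool (i = j) / of_nat n * Y $$ (a, b) else 0))"
    unfolding mult_index[OF assms(1) unit_sl_carrier assms(2,3)]
    using assms by (intro sum.cong) (auto simp: unit_sl_index algebra_simps)
  also have "\<dots> = of_bool (b = j) * Y $$ (a, i) - of_bool (i = j) / of_nat n * Y $$ (a, b)"
    using assms by (simp add: sum_subtractf)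
  finally have 2: "(Y * unit_sl n i j) $$ (a, b) = \<dots>" .
  show ?thesis
    unfolding bracket_index[OF unit_sl_carrier assms(1-3)] 1 2 by simp
qed

lemma bracket_unit_sl:
  assumes "i < n" "j < n" "k < n" "l < n"
  shows "lie_bracket (unit_sl n i j) (unit_sl n k l) =
    of_bool (j = k) \<cdot>\<^sub>m unit_sl n i l + (- of_bool (l = i)) \<cdot>\<^sub>m unit_sl n k j"
proof (rule eq_matI)
  fix a b assume "a < dim_row (of_bool (j = k) \<cdot>\<^sub>m unit_sl n i l + (- of_bool (l = i)) \<cdot>\<^sub>m unit_sl n k j)"
    "b < dim_col (of_bool (j = k) \<cdot>\<^sub>m unit_sl n i l + (- of_bool (l = i)) \<cdot>\<^sub>m unit_sl n k j)"
  then have ab: "a < n" "b < n" by (simp_all add: unit_sl_def)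
  have rhs: "(r \<cdot>\<^sub>m unit_sl n i l + s \<cdot>\<^sub>m unit_sl n k j) $$ (a, b) =
      r * unit_sl n i l $$ (a, b) + s * unit_sl n k j $$ (a, b)" for r s
    using ab by (simp add: unit_sl_def)
  have comm: "(j = b) = (b = j)" "(i = l) = (l = i)" "(k = j) = (j = k)" by auto
  show "lie_bracket (unit_sl n i j) (unit_sl n k l) $$ (a, b) =
    (of_bool (j = k) \<cdot>\<^sub>m unit_sl n i l + (- of_bool (l = i)) \<cdot>\<^sub>m unit_sl n k j) $$ (a, b)"
    unfolding rhs bracket_unit_sl_index[OF unit_sl_carrier ab assms(1,2)] unit_sl_index[OF ab]
      unit_sl_index[OF assms(2) ab(2)] unit_sl_index[OF ab(1) assms(1)]
    by (simp only: of_bool_conj comm) (simp add: algebra_simps)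
qed (auto simp: lie_bracket_def unit_sl_def)

lemma cartan_index: "H \<in> cartan n \<Longrightarrow> a < n \<Longrightarrow> b < n \<Longrightarrow> a \<noteq> b \<Longrightarrow> H $$ (a, b) = 0"
  by (auto simp: cartan_def diagonal_mat_def sl_def)

lemma bracket_cartan_index:
  assumes H: "H \<in> cartan n" and X: "X \<in> carrier_mat n n" and "a < n" "b < n"
  shows "lie_bracket H X $$ (a, b) = (H $$ (a, a) - H $$ (b, b)) * X $$ (a, b)"
proof -
  have Hc: "H \<in> carrier_mat n n" using H by (simp add: cartan_def sl_def)
  have "(H * X) $$ (a, b) = (\<Sum>c<n. if c = a then H $$ (a, a) * X $$ (a, b) else 0)"
    unfolding mult_index[OF Hc X assms(3,4)]
    using assms cartan_index[OF H] by (intro sum.cong) auto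
  moreover have "(X * H) $$ (a, b) = (\<Sum>c<n. if c = b then H $$ (b, b) * X $$ (a, b) else 0)"
    unfolding mult_index[OF X Hc assms(3,4)]
    using assms cartan_index[OF H] by (intro sum.cong) auto
  ultimately show ?thesis
    using assms by (simp add: bracket_index[OF Hc X] algebra_simps)
qed

lemma bracket_carrier [simp]:
  "X \<in> carrier_mat n n \<Longrightarrow> Y \<in> carrier_mat n n \<Longrightarrow> lie_bracket X Y \<in> carrier_mat n n"
  by (auto simp: lie_bracket_def)

text \<open>
  The form is the sum of \<open>(H i - H j) * (K i - K j)\<close> over all \<open>i\<close> and \<open>j\<close>; the mixed terms vanish
  because the traces do.
\<close>

lemma killing_form_cartan:
  assumes H: "H \<in> cartan n" and K: "K \<in> cartan n"
  shows "killing_form n H K = 2 * of_nat n * (\<Sum>i<n. H $$ (i, i) * K $$ (i, i))"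
proof -
  have c: "mat_unit n i j \<in> carrier_mat n n" for i j by (simp add: mat_unit_def)
  have tr: "(\<Sum>i<n. H $$ (i, i)) = 0" "(\<Sum>i<n. K $$ (i, i)) = 0"
    and Kc: "K \<in> carrier_mat n n"
    using H K by (auto simp: cartan_def sl_def)
  have "lie_bracket H (lie_bracket K Z) $$ (i, i) = 0" if "i < n" "Z \<in> carrier_mat n n" for Z i
    using that bracket_cartan_index[OF H bracket_carrier[OF Kc that(2)]] by simp
  then have "(\<Sum>k<n - 1. \<Sum>i\<le>k. lie_bracket H (lie_bracket K
      (mat_unit n k k - mat_unit n (Suc k) (Suc k))) $$ (i, i)) = 0"
    by (intro sum.neutral ballI) (auto simp: c minus_carrier_mat)
  then have "killing_form n H K = (\<Sum>i<n. \<Sum>j\<in>{..<n} - {i}. (H $$ (i, i) - H $$ (j, j)) * (K $$ (i, i) - K $$ (j, j)))"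
    unfolding killing_form_def trace_on_sl_def
    by (auto simp: bracket_cartan_index[OF H] bracket_cartan_index[OF K] c Kc mat_unit_def
        intro!: sum.cong)
  also have "\<dots> = (\<Sum>i<n. \<Sum>j<n. (H $$ (i, i) - H $$ (j, j)) * (K $$ (i, i) - K $$ (j, j)))"
    by (intro sum.cong sum.mono_neutral_left) auto
  also have "\<dots> = (\<Sum>i<n. of_nat n * (H $$ (i, i) * K $$ (i, i)) + (\<Sum>j<n. H $$ (j, j) * K $$ (j, j)))"
    by (intro sum.cong refl)
      (simp add: algebra_simps sum.distrib sum_subtractf tr
        flip: sum_distrib_left sum_distrib_right)
  also have "\<dots> = 2 * of_nat n * (\<Sum>i<n. H $$ (i, i) * K $$ (i, i))"
    by (simp add: sum.distrib flip: sum_distrib_left)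
  finally show ?thesis .
qed

definition diag_root :: "nat \<Rightarrow> nat \<Rightarrow> nat \<Rightarrow> complex mat \<Rightarrow> complex" where
  "diag_root n i j = (\<lambda>H\<in>cartan n. H $$ (i, i) - H $$ (j, j))"

definition unit_diff :: "nat \<Rightarrow> nat \<Rightarrow> nat \<Rightarrow> complex mat" where
  "unit_diff n i j = unit_sl n i i - unit_sl n j j"

lemma unit_diff_index: "a < n \<Longrightarrow> b < n \<Longrightarrow> unit_diff n i j $$ (a, b) =
    of_bool (a = b) * (of_bool (a = i) - of_bool (a = j))"
  by (auto simp: unit_diff_def unit_sl_def)

lemma unit_diff_carrier [simp]: "unit_diff n i j \<in> carrier_mat n n"
  by (simp add: unit_diff_def minus_carrier_mat)

lemma unit_diff_cartan:
  assumes "i < n" "j < n"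
  shows "unit_diff n i j \<in> cartan n"
proof -
  have "(\<Sum>a<n. unit_diff n i j $$ (a, a)) = (\<Sum>a<n. (if a = i then 1 else 0) - (if a = j then 1 else 0))"
    by (intro sum.cong) (auto simp: unit_diff_index)
  also have "\<dots> = 0" using assms by (simp add: sum_subtractf)
  finally show ?thesis
    using carrier_matD[OF unit_diff_carrier[of n i j]]
    by (auto simp: cartan_def sl_def diagonal_mat_def unit_diff_index)
qed

lemma
  assumes "H \<in> cartan n" "i < n" "j < n"
  shows cartan_add_index: "(K + H) $$ (i, j) = K $$ (i, j) + H $$ (i, j)"
    and cartan_smult_index: "(a \<cdot>\<^sub>m H) $$ (i, j) = a * H $$ (i, j)"
  using assms by (auto simp: cartan_def sl_def)

lemma smult_cartan: "H \<in> cartan n \<Longrightarrow> a \<cdot>\<^sub>m H \<in> cartan n"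
  by (auto simp: cartan_def sl_def diagonal_mat_def simp flip: sum_distrib_left)

lemma add_cartan: "H \<in> cartan n \<Longrightarrow> K \<in> cartan n \<Longrightarrow> H + K \<in> cartan n"
  by (auto simp: cartan_def sl_def diagonal_mat_def sum.distrib)

text \<open>
  The bracket with \<open>E i i - E j j\<close> multiplies the entry \<open>(a, b)\<close> by a difference of two numbers in
  \<open>{-1, 0, 1}\<close>, which is \<open>2\<close> only at \<open>(i, j)\<close>.
\<close>

lemma bracket_unit_diff_eigen:
  assumes X: "X \<in> carrier_mat n n" and ij: "i < n" "j < n" "i \<noteq> j"
    and eig: "lie_bracket (unit_diff n i j) X = 2 \<cdot>\<^sub>m X"
  shows "X = X $$ (i, j) \<cdot>\<^sub>m unit_sl n i j"
proof (rule eq_matI)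
  fix a b assume "a < dim_row (X $$ (i, j) \<cdot>\<^sub>m unit_sl n i j)" "b < dim_col (X $$ (i, j) \<cdot>\<^sub>m unit_sl n i j)"
  then have ab: "a < n" "b < n" by (simp_all add: unit_sl_def)
  have "(unit_diff n i j $$ (a, a) - unit_diff n i j $$ (b, b)) * X $$ (a, b) = 2 * X $$ (a, b)"
    using bracket_cartan_index[OF unit_diff_cartan[OF ij(1,2)] X ab] eig ab X by simp
  then have "X $$ (a, b) = 0" if "(a, b) \<noteq> (i, j)"
    using that ab ij by (auto simp: unit_diff_index of_bool_def split: if_splits)
  then show "X $$ (a, b) = (X $$ (i, j) \<cdot>\<^sub>m unit_sl n i j) $$ (a, b)"
    using ab ij by (cases "(a, b) = (i, j)") (auto simp: unit_sl_def)
qed (use X in \<open>auto simp: unit_sl_def\<close>)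

lemma diag_root_in_roots:
  assumes ij: "i < n" "j < n" "i \<noteq> j"
  shows "diag_root n i j \<in> roots n"
  unfolding roots_def
proof (intro CollectI conjI)
  show "diag_root n i j \<in> cartan_dual n"
    using ij by (auto simp: cartan_dual_def diag_root_def add_cartan smult_cartan
        cartan_add_index cartan_smult_index algebra_simps)
  show "\<exists>H\<in>cartan n. diag_root n i j H \<noteq> 0"
    using ij by (intro bexI[of _ "unit_diff n i j"]) (auto simp: diag_root_def unit_diff_cartan unit_diff_index)
  have "unit_sl n i j \<in> root_space n (diag_root n i j)"
    unfolding root_space_def
  proof (intro CollectI conjI ballI unit_sl_in_sl ij)
    fix H assume H: "H \<in> cartan n"
    then have Hc: "H \<in> carrier_mat n n" by (simp add: cartan_def sl_def)
    show "lie_bracket H (unit_sl n i j) = diag_root n i j H \<cdot>\<^sub>m unit_sl n i j"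
    proof (rule eq_matI)
      fix a b assume "a < dim_row (diag_root n i j H \<cdot>\<^sub>m unit_sl n i j)" "b < dim_col (diag_root n i j H \<cdot>\<^sub>m unit_sl n i j)"
      then have ab: "a < n" "b < n" by (simp_all add: unit_sl_def)
      have "(diag_root n i j H \<cdot>\<^sub>m unit_sl n i j) $$ (a, b) = diag_root n i j H * unit_sl n i j $$ (a, b)"
        using ab by (simp add: unit_sl_def)
      then show "lie_bracket H (unit_sl n i j) $$ (a, b) = (diag_root n i j H \<cdot>\<^sub>m unit_sl n i j) $$ (a, b)"
        using H ij by (auto simp: bracket_cartan_index[OF H unit_sl_carrier ab] diag_root_def unit_sl_index ab)
    qed (use Hc in \<open>auto simp: lie_bracket_def unit_sl_def\<close>)
  qed
  moreover have "unit_sl n i j $$ (i, j) \<noteq> 0\<^sub>m n n $$ (i, j)"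
    using ij by (simp add: unit_sl_index)
  ultimately show "root_space n (diag_root n i j) \<noteq> {0\<^sub>m n n}" by auto
qed

lemma inv_form_unit_diff:
  assumes "H \<in> cartan n" "i < n" "j < n"
  shows "inv_form n c (a \<cdot>\<^sub>m unit_diff n i j) H = 2 * c * of_nat n * a * (H $$ (i, i) - H $$ (j, j))"
proof -
  have "(\<Sum>k<n. (a \<cdot>\<^sub>m unit_diff n i j) $$ (k, k) * H $$ (k, k)) =
    (\<Sum>k<n. (if k = i then a * H $$ (i, i) else 0) - (if k = j then a * H $$ (j, j) else 0))"
    by (intro sum.cong) (auto simp: cartan_smult_index[OF unit_diff_cartan[OF assms(2,3)]] unit_diff_index)
  also have "\<dots> = a * (H $$ (i, i) - H $$ (j, j))"
    using assms by (simp add: sum_subtractf algebra_simps)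
  finally show ?thesis
    using assms by (simp add: inv_form_def killing_form_cartan smult_cartan unit_diff_cartan)
qed

text \<open>
  Uniqueness holds because pairing with the traceless part of \<open>E a a\<close> reads off the \<open>a\<close>-th diagonal
  entry.
\<close>

lemma riesz_diag_root:
  assumes ij: "i < n" "j < n" and c: "c \<noteq> 0"
  shows "riesz n c (diag_root n i j) = (1 / (2 * c * of_nat n)) \<cdot>\<^sub>m unit_diff n i j" (is "_ = ?T")
  unfolding riesz_def
proof (rule the_equality)
  have nz: "of_nat n \<noteq> (0 :: complex)" using ij by simp
  show T: "?T \<in> cartan n \<and> (\<forall>H\<in>cartan n. inv_form n c ?T H = diag_root n i j H)"
    using ij c nz by (auto simp: smult_cartan unit_diff_cartan inv_form_unit_diff diag_root_def)
  fix T' assume T': "T' \<in> cartan n \<and> (\<forall>H\<in>cartan n. inv_form n c T' H = diag_root n i j H)"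
  have diag: "inv_form n c X (unit_sl n a a) = 2 * c * of_nat n * X $$ (a, a)"
    if X: "X \<in> cartan n" and a: "a < n" for X a
  proof -
    have "(\<Sum>k<n. X $$ (k, k) * unit_sl n a a $$ (k, k)) =
      (\<Sum>k<n. (if k = a then X $$ (a, a) else 0) - X $$ (k, k) / of_nat n)"
      by (intro sum.cong) (auto simp: unit_sl_index algebra_simps)
    also have "\<dots> = X $$ (a, a)"
      using X a by (simp add: sum_subtractf cartan_def sl_def flip: sum_divide_distrib)
    finally show ?thesis
      using X a by (simp add: inv_form_def killing_form_cartan unit_sl_in_cartan)
  qed
  show "T' = ?T"
  proof (rule eq_matI)
    fix a b assume "a < dim_row ?T" "b < dim_col ?T"
    then have ab: "a < n" "b < n" by (simp_all add: unit_diff_def unit_sl_def)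
    show "T' $$ (a, b) = ?T $$ (a, b)"
    proof (cases "a = b")
      case True
      have "inv_form n c T' (unit_sl n a a) = inv_form n c ?T (unit_sl n a a)"
        using T T' unit_sl_in_cartan ab by simp
      then have "2 * c * of_nat n * T' $$ (a, a) = 2 * c * of_nat n * ?T $$ (a, a)"
        using T T' diag ab by metis
      with True c nz show ?thesis by simp
    next
      case False
      with T T' ab show ?thesis using cartan_index by metis
    qed
  qed (use T' in \<open>auto simp: unit_diff_def unit_sl_def cartan_def sl_def\<close>)
qed

lemma dual_form_diag_root:
  assumes "i < n" "j < n" "i \<noteq> j" "c \<noteq> 0"
  shows "dual_form n c (diag_root n i j) (diag_root n i j) = 1 / (c * of_nat n)"
  using assms unit_diff_cartan[OF assms(1,2)]
  by (simp add: dual_form_def riesz_diag_root inv_form_unit_diff[OF smult_cartan] cartan_smult_index unit_diff_index)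

lemma coroot_diag_root:
  assumes "i < n" "j < n" "i \<noteq> j" "c \<noteq> 0"
  shows "coroot n c (diag_root n i j) = unit_diff n i j"
  using assms by (auto simp: coroot_def dual_form_diag_root riesz_diag_root intro!: eq_matI)

text \<open>
  Root spaces are lines, and the coroot is \<open>E i i - E j j\<close>, the bracket of \<open>E i j\<close> and \<open>E j i\<close>.
  So the normalisation only leaves the choice of mutually inverse scalars, which cancel in the
  Casimir element.
\<close>

lemma root_vectors_unit:
  assumes ef: "root_vectors n c e f" and ij: "i < n" "j < n" "i \<noteq> j" and c: "c \<noteq> 0"
  obtains x y where "e (diag_root n i j) = x \<cdot>\<^sub>m unit_sl n i j" "f (diag_root n i j) = y \<cdot>\<^sub>m unit_sl n j i" "x * y = 1"
proof -
  let ?e = "e (diag_root n i j)" and ?f = "f (diag_root n i j)"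
  have e: "?e \<in> root_space n (diag_root n i j)" and f: "?f \<in> root_space n (\<lambda>H. - diag_root n i j H)"
    and b: "lie_bracket ?e ?f = unit_diff n i j"
    using ef diag_root_in_roots[OF ij] coroot_diag_root[OF ij c] by (auto simp: root_vectors_def)
  have "diag_root n i j (unit_diff n i j) = 2" "diag_root n i j (unit_diff n j i) = -2"
    using ij by (auto simp: diag_root_def unit_diff_cartan unit_diff_index)
  then have "lie_bracket (unit_diff n i j) ?e = 2 \<cdot>\<^sub>m ?e" "lie_bracket (unit_diff n j i) ?f = 2 \<cdot>\<^sub>m ?f"
    and car: "?e \<in> carrier_mat n n" "?f \<in> carrier_mat n n"
    using e f ij by (auto simp: root_space_def unit_diff_cartan sl_def)
  then obtain x y where ex: "?e = x \<cdot>\<^sub>m unit_sl n i j" and fy: "?f = y \<cdot>\<^sub>m unit_sl n j i"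
    using bracket_unit_diff_eigen ij by metis
  have eval: "?e $$ (a, b) = x * of_bool (a = i \<and> b = j)" "?f $$ (a, b) = y * of_bool (a = j \<and> b = i)"
    if "a < n" "b < n" for a b
    using ij that by (simp_all add: ex fy unit_sl_def)
  have "lie_bracket ?e ?f $$ (i, i) = (\<Sum>k<n. ?e $$ (i, k) * ?f $$ (k, i)) - (\<Sum>k<n. ?f $$ (i, k) * ?e $$ (k, i))"
    using ij by (simp only: bracket_index[OF car] mult_index[OF car] mult_index[OF car(2,1)])
  also have "(\<Sum>k<n. ?e $$ (i, k) * ?f $$ (k, i)) = (\<Sum>k<n. if k = j then x * y else 0)"
    using ij by (intro sum.cong) (auto simp: eval)
  also have "(\<Sum>k<n. ?f $$ (i, k) * ?e $$ (k, i)) = 0"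
    using ij by (intro sum.neutral) (auto simp: eval)
  also have "(\<Sum>k<n. if k = j then x * y else 0) - 0 = x * y" using ij by simp
  finally have "x * y = 1" using b ij by (simp add: unit_diff_index)
  with ex fy show ?thesis using that by blast
qed

section \<open>The action of the enveloping algebra\<close>

lemma smult_sl: "X \<in> sl n \<Longrightarrow> a \<cdot>\<^sub>m X \<in> sl n"
  by (auto simp: sl_def simp flip: sum_distrib_left)

text \<open>
  The traceless parts of the matrix units span \<open>sl n\<close>: from a nonzero matrix one can subtract a
  multiple of such a unit off the diagonal, or of a difference of two on the diagonal, so that an
  entry becomes zero while no zero entry is lost.  On the diagonal this uses that a traceless matrix
  with a nonzero diagonal entry has a second one.
\<close>

lemma sl_unit_induct [consumes 1, case_names zero unit lincomb]:
  assumes "X \<in> sl n"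
    and zero: "P (0\<^sub>m n n)"
    and unit: "\<And>i j. i < n \<Longrightarrow> j < n \<Longrightarrow> P (unit_sl n i j)"
    and lincomb: "\<And>a X Y. X \<in> sl n \<Longrightarrow> Y \<in> sl n \<Longrightarrow> P X \<Longrightarrow> P Y \<Longrightarrow> P (X + a \<cdot>\<^sub>m Y)"
  shows "P X"
  using assms(1)
proof (induction "card {(a, b). a < n \<and> b < n \<and> X $$ (a, b) \<noteq> 0}" arbitrary: X rule: less_induct)
  case less
  let ?supp = "\<lambda>X. {(a, b). a < n \<and> b < n \<and> X $$ (a, b) \<noteq> (0 :: complex)}"
  have fin: "finite (?supp X)" for X :: "complex mat"
    by (rule finite_subset[of _ "{..<n} \<times> {..<n}"]) auto
  have X: "X \<in> carrier_mat n n" using less.prems by (rule sl_carrier)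
  have step: "P X" if Z: "Z \<in> sl n" "P Z" "Z $$ (a, b) = 1" "?supp Z \<subseteq> ?supp X" and ab: "a < n" "b < n" for Z a b
  proof -
    let ?x = "X $$ (a, b)" and ?Y = "X + (- X $$ (a, b)) \<cdot>\<^sub>m Z"
    have Zc: "Z \<in> carrier_mat n n" using Z(1) by (rule sl_carrier)
    have Y: "?Y \<in> sl n"
    proof -
      have "1 \<cdot>\<^sub>m X = X" by (intro eq_matI) auto
      with sl_lincomb[OF less.prems Z(1), of 1 "- ?x"] show ?thesis by simp
    qed
    have Yi: "?Y $$ (r, s) = X $$ (r, s) - ?x * Z $$ (r, s)" if "r < n" "s < n" for r s
      using that Zc by simp
    have "?supp ?Y \<subseteq> ?supp X"
    proof (rule subsetI)
      fix z assume "z \<in> ?supp ?Y"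
      then obtain r s where z: "z = (r, s)" and rs: "r < n" "s < n" "?Y $$ (r, s) \<noteq> 0" by blast
      have "X $$ (r, s) \<noteq> 0"
      proof
        assume "X $$ (r, s) = 0"
        then have "Z $$ (r, s) = 0" using Z(4) rs by blast
        with \<open>X $$ (r, s) = 0\<close> rs Yi show False by simp
      qed
      then show "z \<in> ?supp X" using z rs by blast
    qed
    moreover have "(a, b) \<in> ?supp X" using Z(3,4) ab by force
    moreover have "(a, b) \<notin> ?supp ?Y" using Yi[OF ab] Z(3) by simp
    ultimately have "?supp ?Y \<subset> ?supp X" by blast
    then have "P ?Y" by (intro less.hyps[OF psubset_card_mono[OF fin] Y])
    moreover have "X = ?Y + ?x \<cdot>\<^sub>m Z"
      using X Zc by (intro eq_matI) auto
    ultimately show ?thesis using lincomb[OF Y Z(1) _ Z(2), of ?x] by simp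
  qed
  show ?case
  proof (cases "\<exists>a b. a < n \<and> b < n \<and> a \<noteq> b \<and> X $$ (a, b) \<noteq> 0")
    case True
    then obtain a b where ab: "a < n" "b < n" "a \<noteq> b" "X $$ (a, b) \<noteq> 0" by blast
    then show ?thesis
      by (intro step[of "unit_sl n a b" a b] unit unit_sl_in_sl) (auto simp: unit_sl_index)
  next
    case off: False
    show ?thesis
    proof (cases "\<exists>a<n. X $$ (a, a) \<noteq> 0")
      case True
      then obtain a where a: "a < n" "X $$ (a, a) \<noteq> 0" by blast
      have "\<exists>b<n. b \<noteq> a \<and> X $$ (b, b) \<noteq> 0"
      proof (rule ccontr)
        assume "\<not> ?thesis"
        then have "(\<Sum>b<n. X $$ (b, b)) = (\<Sum>b\<in>{a}. X $$ (b, b))"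
          using a by (intro sum.mono_neutral_right) auto
        with a less.prems show False by (simp add: sl_def)
      qed
      then obtain b where b: "b < n" "b \<noteq> a" "X $$ (b, b) \<noteq> 0" by blast
      have "unit_diff n a b = unit_sl n a a + (- 1) \<cdot>\<^sub>m unit_sl n b b"
        by (auto simp: unit_diff_def unit_sl_def intro!: eq_matI)
      then have "P (unit_diff n a b)"
        using a b by (simp only: lincomb unit unit_sl_in_sl)
      then show ?thesis
        using a b by (intro step[of "unit_diff n a b" a a] cartan_sl unit_diff_cartan)
          (auto simp: unit_diff_index of_bool_def split: if_splits)
    next
      case False
      with off have "X $$ (a, b) = 0" if "a < n" "b < n" for a b
        using that by (cases "a = b") auto
      then have "X = 0\<^sub>m n n" using X by (intro eq_matI) auto
      with zero show ?thesis by simp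
    qed
  qed
qed

context sl_rep
begin

lemma rep_zero: "\<rho> (0\<^sub>m n n) v = 0"
proof -
  have "0\<^sub>m n n \<in> sl n" by (simp add: sl_def)
  from rep_smult[OF this, of 0 v] show ?thesis by (simp add: smult_zero_mat)
qed

lemma
  assumes "X \<in> sl n"
  shows rep_linear_add: "\<rho> X (x + y) = \<rho> X x + \<rho> X y"
    and rep_linear_diff: "\<rho> X (x - y) = \<rho> X x - \<rho> X y"
    and rep_linear_scale: "\<rho> X (scale a x) = scale a (\<rho> X x)"
    and rep_linear_zero: "\<rho> X 0 = 0"
proof -
  interpret L: Vector_Spaces.linear scale scale "\<rho> X" using assms by (rule linear_rep)
  show "\<rho> X (x + y) = \<rho> X x + \<rho> X y" "\<rho> X (scale a x) = scale a (\<rho> X x)"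
    "\<rho> X (x - y) = \<rho> X x - \<rho> X y" "\<rho> X 0 = 0"
    by (simp_all add: L.add L.scale L.diff)
qed

lemma rep_unit_comm:
  assumes "i < n" "j < n" "k < n" "l < n"
  shows "\<rho> (unit_sl n i j) (\<rho> (unit_sl n k l) v) = \<rho> (unit_sl n k l) (\<rho> (unit_sl n i j) v)
    + (if j = k then \<rho> (unit_sl n i l) v else 0) - (if l = i then \<rho> (unit_sl n k j) v else 0)"
proof -
  have sl: "unit_sl n r s \<in> sl n" "a \<cdot>\<^sub>m unit_sl n r s \<in> sl n" if "r < n" for r s a
    using unit_sl_in_sl[OF that, of s] by (simp_all add: smult_sl)
  have "\<rho> (unit_sl n i j) (\<rho> (unit_sl n k l) v) - \<rho> (unit_sl n k l) (\<rho> (unit_sl n i j) v)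
    = \<rho> (lie_bracket (unit_sl n i j) (unit_sl n k l)) v"
    using assms by (simp add: rep_bracket sl)
  also have "\<dots> = scale (of_bool (j = k)) (\<rho> (unit_sl n i l) v) + scale (- of_bool (l = i)) (\<rho> (unit_sl n k j) v)"
    unfolding bracket_unit_sl[OF assms] using assms by (simp only: rep_add sl rep_smult)
  finally show ?thesis by (auto simp: algebra_simps)
qed

text \<open>
  The extension of the representation to \<open>gl n\<close> in which the identity matrix acts by \<open>n * t\<close>.
\<close>

definition gl_op :: "complex \<Rightarrow> nat \<Rightarrow> nat \<Rightarrow> 'v \<Rightarrow> 'v" where
  "gl_op t i j v = \<rho> (unit_sl n i j) v + (if i = j then scale t v else 0)"

lemma gl_rep_gl_op: "gl_rep scale n (gl_op t)"
proof (intro gl_rep.intro gl_rep_axioms.intro vector_space_axioms)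
  fix i j assume ij: "i < n" "j < n"
  show "Vector_Spaces.linear scale scale (gl_op t i j)"
    unfolding gl_op_def[abs_def] using unit_sl_in_sl[OF ij(1), of j]
    by unfold_locales (auto simp: rep_linear_add rep_linear_scale algebra_simps)
next
  fix i j k l v assume ind: "i < n" "j < n" "k < n" "l < n"
  then show "gl_op t i j (gl_op t k l v) = gl_op t k l (gl_op t i j v)
      + (if j = k then gl_op t i l v else 0) - (if l = i then gl_op t k j v else 0)"
    by (auto simp: gl_op_def rep_linear_zero rep_linear_add rep_linear_scale unit_sl_in_sl rep_unit_comm[of i j k l]
        algebra_simps)
qed

abbreviation env_coset :: "(complex mat list \<Rightarrow> complex) \<Rightarrow> (complex mat list \<Rightarrow> complex) set" where
  "env_coset a \<equiv> env_ideal n +>\<^bsub>free_algebra (sl n)\<^esub> a"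

lemma env_coset_hom: "env_coset \<in> ring_hom (free_algebra (sl n)) (univ_env n)"
  unfolding univ_env_def by (rule ideal.rcos_ring_hom[OF ideal_env_ideal])

lemma env_coset_exE:
  assumes "u \<in> carrier (univ_env n)"
  obtains a where "a \<in> carrier (free_algebra (sl n))" "u = env_coset a"
  using assms unfolding univ_env_def FactRing_def by (auto simp: A_RCOSETS_def')

lemma
  assumes "u \<in> carrier (univ_env n)" "v \<in> carrier (univ_env n)"
  shows env_act_add: "env_act scale \<rho> (u \<oplus>\<^bsub>univ_env n\<^esub> v) x = env_act scale \<rho> u x + env_act scale \<rho> v x"
    and env_act_mult: "env_act scale \<rho> (u \<otimes>\<^bsub>univ_env n\<^esub> v) x = env_act scale \<rho> u (env_act scale \<rho> v x)"
proof -
  interpret F: ring "free_algebra (sl n)" by (rule ring_free_algebra)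
  obtain a b where a: "a \<in> carrier (free_algebra (sl n))" "u = env_coset a"
    and b: "b \<in> carrier (free_algebra (sl n))" "v = env_coset b"
    using assms by (metis env_coset_exE)
  have ab: "a \<oplus>\<^bsub>free_algebra (sl n)\<^esub> b = (\<lambda>w. a w + b w)" by (simp add: free_algebra_def)
  have "u \<oplus>\<^bsub>univ_env n\<^esub> v = env_coset (a \<oplus>\<^bsub>free_algebra (sl n)\<^esub> b)"
    using ring_hom_add[OF env_coset_hom a(1) b(1)] a b by simp
  then have "env_act scale \<rho> (u \<oplus>\<^bsub>univ_env n\<^esub> v) x = free_act scale \<rho> (a \<oplus>\<^bsub>free_algebra (sl n)\<^esub> b) x"
    using a b by (simp only: env_act_coset F.a_closed)
  then show "env_act scale \<rho> (u \<oplus>\<^bsub>univ_env n\<^esub> v) x = env_act scale \<rho> u x + env_act scale \<rho> v x"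
    using a b by (simp add: env_act_coset ab free_act_add[OF a(1) b(1)])
  have "u \<otimes>\<^bsub>univ_env n\<^esub> v = env_coset (a \<otimes>\<^bsub>free_algebra (sl n)\<^esub> b)"
    using ring_hom_mult[OF env_coset_hom a(1) b(1)] a b by simp
  then show "env_act scale \<rho> (u \<otimes>\<^bsub>univ_env n\<^esub> v) x = env_act scale \<rho> u (env_act scale \<rho> v x)"
    using a b by (simp add: env_act_coset free_act_mult)
qed

lemma env_scalar_carrier: "env_scalar n a \<in> carrier (univ_env n)"
  unfolding env_scalar_def by (intro ring_hom_closed[OF env_coset_hom] free_word_carrier) simp

lemma env_incl_carrier: "X \<in> sl n \<Longrightarrow> env_incl n X \<in> carrier (univ_env n)"
  unfolding env_incl_def by (intro ring_hom_closed[OF env_coset_hom] free_word_carrier) simp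

lemma env_act_scalar: "env_act scale \<rho> (env_scalar n a) x = scale a x"
  unfolding env_scalar_def by (simp add: env_act_coset free_word_carrier free_act_word)

lemma env_act_incl: "X \<in> sl n \<Longrightarrow> env_act scale \<rho> (env_incl n X) x = \<rho> X x"
  unfolding env_incl_def by (simp add: env_act_coset free_word_carrier free_act_word)

lemma env_act_one: "env_act scale \<rho> \<one>\<^bsub>univ_env n\<^esub> x = x"
proof -
  have "\<one>\<^bsub>free_algebra (sl n)\<^esub> = free_word 1 []"
    by (auto simp: free_algebra_def free_word_def)
  then have "\<one>\<^bsub>univ_env n\<^esub> = env_scalar n 1"
    using ring_hom_one[OF env_coset_hom] by (simp add: env_scalar_def)
  then show ?thesis by (simp add: env_act_scalar)
qed

lemma env_act_a_inv:
  assumes u: "u \<in> carrier (univ_env n)"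
  shows "env_act scale \<rho> (\<ominus>\<^bsub>univ_env n\<^esub> u) x = - env_act scale \<rho> u x"
proof -
  interpret U: ring "univ_env n" by (rule ring_univ_env)
  have "\<zero>\<^bsub>univ_env n\<^esub> \<oplus>\<^bsub>univ_env n\<^esub> \<zero>\<^bsub>univ_env n\<^esub> = \<zero>\<^bsub>univ_env n\<^esub>" by simp
  then have "env_act scale \<rho> \<zero>\<^bsub>univ_env n\<^esub> x = 0"
    using env_act_add[OF U.zero_closed U.zero_closed, of x] by simp
  then show ?thesis
    using env_act_add[OF u U.a_inv_closed[OF u], of x] U.r_neg[OF u] by (simp add: eq_neg_iff_add_eq_0 add.commute)
qed

lemma
  assumes "e \<alpha> \<in> sl n" "f \<alpha> \<in> sl n"
  shows kappa_carrier: "kappa n c e f \<alpha> \<in> carrier (univ_env n)"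
    and env_act_kappa: "env_act scale \<rho> (kappa n c e f \<alpha>) x =
      scale (dual_form n c \<alpha> \<alpha> / 2) (\<rho> (e \<alpha>) (\<rho> (f \<alpha>) x) + \<rho> (f \<alpha>) (\<rho> (e \<alpha>) x))"
proof -
  interpret U: ring "univ_env n" by (rule ring_univ_env)
  note [simp] = env_incl_carrier[OF assms(1)] env_incl_carrier[OF assms(2)] env_scalar_carrier
  show "kappa n c e f \<alpha> \<in> carrier (univ_env n)" by (simp add: kappa_def)
  show "env_act scale \<rho> (kappa n c e f \<alpha>) x =
      scale (dual_form n c \<alpha> \<alpha> / 2) (\<rho> (e \<alpha>) (\<rho> (f \<alpha>) x) + \<rho> (f \<alpha>) (\<rho> (e \<alpha>) x))"
    using assms by (simp add: kappa_def env_act_mult env_act_add env_act_scalar env_act_incl)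
qed

lemma subspace_weight_space: "subspace (weight_space n scale \<rho> \<mu>)"
  unfolding subspace_def weight_space_def
proof (intro conjI CollectI ballI allI)
  fix H assume "H \<in> cartan n"
  then have "\<rho> H (scale 0 0) = scale 0 (\<rho> H 0)" by (intro rep_linear_scale cartan_sl)
  then show "\<rho> H 0 = scale (\<mu> H) 0" by simp
qed (auto simp: rep_linear_add rep_linear_scale cartan_sl algebra_simps)

lemma rep_cartan_root_vector:
  assumes X: "X \<in> root_space n \<beta>" and H: "H \<in> cartan n"
  shows "\<rho> H (\<rho> X v) = \<rho> X (\<rho> H v) + scale (\<beta> H) (\<rho> X v)"
proof -
  have Xs: "X \<in> sl n" and "lie_bracket H X = \<beta> H \<cdot>\<^sub>m X" using X H by (auto simp: root_space_def)
  then have "\<rho> H (\<rho> X v) - \<rho> X (\<rho> H v) = scale (\<beta> H) (\<rho> X v)"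
    using rep_bracket[OF cartan_sl[OF H] Xs, of v] rep_smult[OF Xs] by simp
  then show ?thesis by (simp add: algebra_simps)
qed

text \<open>
  The weights of \<open>e \<alpha>\<close> and \<open>f \<alpha>\<close> cancel, so the generators preserve every weight space.
\<close>

lemma casimir_preserves_weight_space:
  assumes ef: "root_vectors n c e f"
    and a: "a \<in> casimir_algebra n c e f" and w: "w \<in> weight_space n scale \<rho> \<mu>"
  shows "env_act scale \<rho> a w \<in> weight_space n scale \<rho> \<mu>"
proof -
  let ?W = "weight_space n scale \<rho> \<mu>"
  let ?G = "range (env_scalar n) \<union> kappa n c e f ` roots n \<union> env_incl n ` cartan n"
  interpret U: ring "univ_env n" by (rule ring_univ_env)
  note W = subspace_weight_space[of \<mu>]
  have es: "e \<alpha> \<in> root_space n \<alpha>" "f \<alpha> \<in> root_space n (\<lambda>H. - \<alpha> H)" "e \<alpha> \<in> sl n" "f \<alpha> \<in> sl n" if "\<alpha> \<in> roots n" for \<alpha>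
    using ef that by (auto simp: root_vectors_def root_space_def)
  have G: "?G \<subseteq> carrier (univ_env n)"
    by (auto simp: env_scalar_carrier env_incl_carrier cartan_sl kappa_carrier es)
  have gen: "env_act scale \<rho> g w \<in> ?W" if "g \<in> ?G" "w \<in> ?W" for g w
    using that(1)
  proof (elim UnE imageE rangeE)
    fix \<alpha> assume \<alpha>: "\<alpha> \<in> roots n" and g: "g = kappa n c e f \<alpha>"
    have "\<rho> (e \<alpha>) (\<rho> (f \<alpha>) w) \<in> ?W" "\<rho> (f \<alpha>) (\<rho> (e \<alpha>) w) \<in> ?W"
      using that(2) es[OF \<alpha>] unfolding weight_space_def
      by (auto simp: rep_cartan_root_vector[where \<beta> = \<alpha>] rep_cartan_root_vector[where \<beta> = "\<lambda>H. - \<alpha> H"]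
          rep_linear_diff rep_linear_add rep_linear_scale algebra_simps)
    then show ?thesis
      unfolding g env_act_kappa[of e \<alpha> f, OF es(3,4)[OF \<alpha>]] using W by (intro subspace_scale subspace_add)
  next
    fix H assume H: "H \<in> cartan n" and g: "g = env_incl n H"
    have "\<rho> H w = scale (\<mu> H) w" using that(2) H by (simp add: weight_space_def)
    then show ?thesis
      unfolding g env_act_incl[OF cartan_sl[OF H]] using W that(2) by (simp add: subspace_scale)
  qed (use W that(2) in \<open>auto simp: env_act_scalar subspace_scale\<close>)
  show ?thesis
    using a w unfolding casimir_algebra_def
  proof (induction a arbitrary: w rule: generate_ring.induct)
    case (a_inv h)
    then show ?case
      using U.generate_ring_in_carrier[OF G a_inv.hyps] W by (simp add: env_act_a_inv subspace_neg)
  next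
    case (eng_add g h)
    then show ?case
      using U.generate_ring_in_carrier[OF G] W by (simp add: env_act_add subspace_add)
  next
    case (eng_mult g h)
    then show ?case
      using U.generate_ring_in_carrier[OF G] by (simp add: env_act_mult)
  qed (auto simp: env_act_one gen)
qed

text \<open>
  The scalar \<open>\<langle>\<alpha>, \<alpha>\<rangle> / 2\<close> in the Casimir element is nonzero and can be divided out.
\<close>

lemma casimir_algebra_stable:
  assumes ef: "root_vectors n c e f" and c: "c \<noteq> 0"
    and S: "subspace S" "\<forall>a\<in>casimir_algebra n c e f. \<forall>s\<in>S. env_act scale \<rho> a s \<in> S"
    and s: "s \<in> S"
  shows "H \<in> cartan n \<Longrightarrow> \<rho> H s \<in> S"
    and "i < n \<Longrightarrow> j < n \<Longrightarrow> i \<noteq> j \<Longrightarrow> \<rho> (unit_sl n i j) (\<rho> (unit_sl n j i) s)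
      + \<rho> (unit_sl n j i) (\<rho> (unit_sl n i j) s) \<in> S"
proof -
  assume H: "H \<in> cartan n"
  then have "env_incl n H \<in> casimir_algebra n c e f"
    unfolding casimir_algebra_def by (intro generate_ring.incl) auto
  with S(2) s have "env_act scale \<rho> (env_incl n H) s \<in> S" by blast
  with H show "\<rho> H s \<in> S" by (simp add: env_act_incl cartan_sl)
next
  assume ij: "i < n" "j < n" "i \<noteq> j"
  let ?\<alpha> = "diag_root n i j" and ?E = "unit_sl n i j" and ?F = "unit_sl n j i"
  obtain x y where e: "e ?\<alpha> = x \<cdot>\<^sub>m ?E" and f: "f ?\<alpha> = y \<cdot>\<^sub>m ?F" and xy: "x * y = 1"
    using root_vectors_unit[OF ef ij c] .
  have sl: "?E \<in> sl n" "?F \<in> sl n" using unit_sl_in_sl ij by auto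
  have \<alpha>: "?\<alpha> \<in> roots n" using diag_root_in_roots[OF ij] .
  then have "e ?\<alpha> \<in> sl n" "f ?\<alpha> \<in> sl n" using ef by (auto simp: root_vectors_def root_space_def)
  note act = env_act_kappa[of e ?\<alpha> f c s, OF this]
  have "kappa n c e f ?\<alpha> \<in> casimir_algebra n c e f"
    unfolding casimir_algebra_def using \<alpha> by (intro generate_ring.incl) auto
  with S(2) s have mem: "env_act scale \<rho> (kappa n c e f ?\<alpha>) s \<in> S" by blast
  have nz: "dual_form n c ?\<alpha> ?\<alpha> \<noteq> 0" using dual_form_diag_root[OF ij c] c ij by simp
  have "env_act scale \<rho> (kappa n c e f ?\<alpha>) s =
    scale (dual_form n c ?\<alpha> ?\<alpha> / 2) (\<rho> ?E (\<rho> ?F s) + \<rho> ?F (\<rho> ?E s))"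
    unfolding act using xy by (simp add: e f rep_smult sl rep_linear_scale mult.commute)
  with subspace_scale[OF S(1) mem, of "2 / dual_form n c ?\<alpha> ?\<alpha>"] nz
  show "\<rho> ?E (\<rho> ?F s) + \<rho> ?F (\<rho> ?E s) \<in> S" by simp
qed

end

section \<open>Irreducibility of the weight spaces\<close>

theorem theorem6p1:
  fixes n p q :: nat
    and c :: complex
    and e f :: "(complex mat \<Rightarrow> complex) \<Rightarrow> complex mat"
    and scale :: "complex \<Rightarrow> 'v::ab_group_add \<Rightarrow> 'v"
    and \<rho> :: "complex mat \<Rightarrow> 'v \<Rightarrow> 'v"
    and \<mu> :: "complex mat \<Rightarrow> complex"
  assumes "n \<ge> 2"
    and "c \<noteq> 0"
    and "root_vectors n c e f"
    and "simple_highest_weight_module n scale \<rho>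
           (weight_of n (\<lambda>i. if i = 0 then int p else if i = n - 1 then - int q else 0))"
    and "\<mu> \<in> cartan_dual n"
    and "weight_space n scale \<rho> \<mu> \<noteq> {0}"
  shows "acts_irreducibly scale (env_act scale \<rho>) (casimir_algebra n c e f)
           (weight_space n scale \<rho> \<mu>)"
proof -
  let ?l = "\<lambda>i. if i = 0 then int p else if i = n - 1 then - int q else 0"
  let ?W = "weight_space n scale \<rho> \<mu>"
  interpret sl_rep n scale \<rho>
    using assms(4) by (simp add: simple_highest_weight_module_def)
  obtain v where v: "v \<in> weight_space n scale \<rho> (weight_of n ?l)" "v \<noteq> 0"
    and prim: "\<And>i j. i < j \<Longrightarrow> j < n \<Longrightarrow> \<rho> (mat_unit n i j) v = 0"
    using assms(4) by (auto simp: simple_highest_weight_module_def has_highest_weight_def)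
  \<comment> \<open>With this scalar the diagonal units act on \<open>v\<close> by the entries of the sequence itself.\<close>
  define t :: complex where "t = (of_nat p - of_nat q) / of_nat n"
  define wt :: "nat \<Rightarrow> complex" where "wt i = of_int (?l i)" for i
  interpret G: gl_rep scale n "gl_op t" by (rule gl_rep_gl_op)
  have sum_l: "(\<Sum>k<n. wt k) = of_nat p - of_nat q"
  proof -
    have "(\<Sum>k<n. wt k) = (\<Sum>k<n. (if k = 0 then of_nat p else 0) - (if k = n - 1 then of_nat q else 0))"
      using assms(1) by (intro sum.cong) (auto simp: wt_def)
    also have "\<dots> = of_nat p - of_nat q"
      using assms(1) by (simp add: sum_subtractf)
    finally show ?thesis .
  qed
  have wt_unit: "weight_of n ?l (unit_sl n i i) = wt i - t" if "i < n" for i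
  proof -
    have "weight_of n ?l (unit_sl n i i) = (\<Sum>k<n. (if k = i then wt i else 0) - wt k / of_nat n)"
      unfolding weight_of_def restrict_apply'[OF unit_sl_in_cartan[OF that]]
      by (intro sum.cong) (auto simp: unit_sl_index wt_def algebra_simps)
    also have "\<dots> = wt i - t"
      using that by (simp add: sum_subtractf sum_l t_def flip: sum_divide_distrib)
    finally show ?thesis .
  qed
  interpret V: simple_gl_rep scale n "gl_op t" v wt
  proof
    fix S assume S: "G.invariant S"
    then have sub: "subspace S" by (simp add: G.invariant_def)
    have "\<forall>s\<in>S. \<rho> X s \<in> S" if "X \<in> sl n" for X
      using that
    proof (induction rule: sl_unit_induct)
      case zero
      show ?case using sub by (simp add: rep_zero subspace_0)
    next
      case (unit i j)
      show ?case
      proof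
        fix s assume "s \<in> S"
        with S unit have "gl_op t i j s - (if i = j then scale t s else 0) \<in> S"
          using sub by (auto simp: G.invariant_def intro!: subspace_diff subspace_scale subspace_0)
        then show "\<rho> (unit_sl n i j) s \<in> S" by (simp add: gl_op_def)
      qed
    next
      case (lincomb a X Y)
      have "a \<cdot>\<^sub>m Y \<in> sl n" using lincomb(2) by (rule smult_sl)
      with lincomb sub show ?case by (simp add: rep_add rep_smult subspace_add subspace_scale)
    qed
    with sub assms(4) show "S = {0} \<or> S = UNIV"
      unfolding simple_highest_weight_module_def acts_irreducibly_def by blast
  next
    show "v \<noteq> 0" by fact
    show "G.primitive v"
      unfolding G.primitive_def gl_op_def using prim by (auto simp: unit_sl_off_diag)
    have "\<rho> (unit_sl n i i) v = scale (wt i - t) v" if "i < n" for i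
      using v(1) unit_sl_in_cartan[OF that] wt_unit[OF that] by (simp add: weight_space_def)
    then show "G.is_weight_vector wt v"
      unfolding G.is_weight_vector_def gl_op_def by (simp add: algebra_simps)
    show "wt i = 0" if "0 < i" "i < n - 1" for i
      using that by (simp add: wt_def)
  qed
  have weight: "G.is_weight_vector (\<lambda>i. \<mu> (unit_sl n i i) + t) w" if "w \<in> ?W" for w
    using that unit_sl_in_cartan
    by (auto simp: G.is_weight_vector_def gl_op_def weight_space_def algebra_simps)
  have "S = {0} \<or> S = ?W"
    if S: "S \<subseteq> ?W" "subspace S" "\<forall>a\<in>casimir_algebra n c e f. \<forall>s\<in>S. env_act scale \<rho> a s \<in> S" for S
  proof -
    interpret C: casimir_stable scale n "gl_op t" v wt S
    proof
      show "subspace S" by fact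
      fix i s assume "i < n" and s: "s \<in> S"
      have "\<rho> (unit_sl n i i) s \<in> S"
        by (rule casimir_algebra_stable(1)[OF assms(3,2) S(2,3) s unit_sl_in_cartan[OF \<open>i < n\<close>]])
      with S(2) s show "gl_op t i i s \<in> S"
        by (simp add: gl_op_def subspace_add subspace_scale)
    next
      fix i j s assume ij: "i < n" "j < n" "i \<noteq> j" and s: "s \<in> S"
      from casimir_algebra_stable(2)[OF assms(3,2) S(2,3) s ij] ij(3)
      show "gl_op t i j (gl_op t j i s) + gl_op t j i (gl_op t i j s) \<in> S"
        by (simp add: gl_op_def)
    qed
    have "?W \<subseteq> S" if "S \<noteq> {0}"
    proof -
      have "0 \<in> S" using S(2) by (rule subspace_0)
      with that obtain s where "s \<in> S" "s \<noteq> 0" by blast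
      then show ?thesis using C.weight_vector_in_S[OF _ _ weight weight] S(1) by auto
    qed
    with S(1) show ?thesis by blast
  qed
  then show ?thesis
    unfolding acts_irreducibly_def
    using subspace_weight_space assms(6) casimir_preserves_weight_space[OF assms(3)] by blast
qed

end
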